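(* Let $q$ be a prime power and $d$ a natural number. There is an algorithm that, given two $n\times n$ matrices $A,B$ over $\mathbb F_q$, both of twin-width at most $d$, computes the product $AB$ in time $\mathcal O_{d,q}(n^2\log n)$ (the constant hidden in the $\mathcal O$ depending only on $d$ and $q$).
   Context: A matrix over a finite alphabet with row set $R$ and column set $C$ is identified with the ordered binary structure on $R\uplus C$ with a unary relation for rows, a total order extending the row and column orders with rows before columns, and for each symbol $a$ a binary relation $E_a(r,c)$ holding iff $r$ is a row, $c$ a column and the entry is $a$. Twin-width: a contraction sequence is a sequence of partitions of the domain from singletons to a single part, each obtained from the previous one by merging two parts; two distinct parts $X,Y$ are red-adjacent if there are $u,u'\in X$, $v,v'\in Y$ with $(u,v)$ and $(u',v')$ of different atomic types (atomic type: which unary relations contain each element and which binary relations contain $(u,v)$ and $(v,u)$); the twin-width is the least $d$ such that some contraction sequence has every part red-adjacent to at most $d$ others at every step. The input matrices are given explicitly (no contraction sequence is provided). *)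

theory Defs
  imports
    Complex_Main
    "HOL-Library.Landau_Symbols"
    "HOL-Number_Theory.Prime_Powers"
    "Jordan_Normal_Form.Matrix"
begin

section \<open>Binary structures and twin-width\<close>

text \<open>Structures with unary relations indexed by \<^typ>\<open>'u\<close> and binary relations indexed by
  \<^typ>\<open>'b\<close>.\<close>

record ('v, 'u, 'b) binary_structure =
  universe :: "'v set"
  unary_rel :: "'u \<Rightarrow> 'v set"
  binary_rel :: "'b \<Rightarrow> ('v \<times> 'v) set"

definition atomic_type ::
  "('v, 'u, 'b) binary_structure \<Rightarrow> 'v \<Rightarrow> 'v \<Rightarrow> 'u set \<times> 'u set \<times> 'b set \<times> 'b set" where
  "atomic_type S u v =
     ({i. u \<in> unary_rel S i}, {i. v \<in> unary_rel S i},
      {b. (u, v) \<in> binary_rel S b}, {b. (v, u) \<in> binary_rel S b})"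

definition red_adjacent :: "('v, 'u, 'b) binary_structure \<Rightarrow> 'v set \<Rightarrow> 'v set \<Rightarrow> bool" where
  "red_adjacent S X Y \<longleftrightarrow> X \<noteq> Y \<and>
     (\<exists>u\<in>X. \<exists>u'\<in>X. \<exists>v\<in>Y. \<exists>v'\<in>Y. atomic_type S u v \<noteq> atomic_type S u' v')"

definition merge_step :: "'v set set \<Rightarrow> 'v set set \<Rightarrow> bool" where
  "merge_step P P' \<longleftrightarrow>
     (\<exists>X\<in>P. \<exists>Y\<in>P. X \<noteq> Y \<and> P' = insert (X \<union> Y) (P - {X, Y}))"

definition contraction_sequence :: "'v set \<Rightarrow> 'v set set list \<Rightarrow> bool" where
  "contraction_sequence D Ps \<longleftrightarrow>
     Ps \<noteq> [] \<and> hd Ps = (\<lambda>x. {x}) ` D \<and> last Ps = {D} \<and>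
     (\<forall>i. Suc i < length Ps \<longrightarrow> merge_step (Ps ! i) (Ps ! Suc i))"

text \<open>Meaningful for finite nonempty universes, where a contraction sequence exists; for the
  empty universe there is none and the value is unspecified.\<close>

definition twin_width :: "('v, 'u, 'b) binary_structure \<Rightarrow> nat" where
  "twin_width S = (LEAST d. \<exists>Ps. contraction_sequence (universe S) Ps \<and>
     (\<forall>P\<in>set Ps. \<forall>X\<in>P. card {Y \<in> P. red_adjacent S X Y} \<le> d))"

text \<open>The structure of a matrix: row \<open>i\<close> is \<^term>\<open>Inl i\<close>, column \<open>j\<close> is \<^term>\<open>Inr j\<close>; the only
  unary relation (index type \<^typ>\<open>unit\<close>) is the set of rows.\<close>

datatype 'a matrix_rel = Order | Entry 'a

definition matrix_universe :: "'a mat \<Rightarrow> (nat + nat) set" where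
  "matrix_universe A = {..<dim_row A} <+> {..<dim_col A}"

fun row_col_le :: "nat + nat \<Rightarrow> nat + nat \<Rightarrow> bool" where
  "row_col_le (Inl i) (Inl i') = (i \<le> i')"
| "row_col_le (Inr j) (Inr j') = (j \<le> j')"
| "row_col_le (Inl i) (Inr j) = True"
| "row_col_le (Inr j) (Inl i) = False"

fun matrix_binary_rel :: "'a mat \<Rightarrow> 'a matrix_rel \<Rightarrow> ((nat + nat) \<times> (nat + nat)) set" where
  "matrix_binary_rel A Order =
     {(x, y). x \<in> matrix_universe A \<and> y \<in> matrix_universe A \<and> row_col_le x y}"
| "matrix_binary_rel A (Entry a) =
     {(Inl i, Inr j) | i j. i < dim_row A \<and> j < dim_col A \<and> A $$ (i, j) = a}"

definition matrix_structure :: "'a mat \<Rightarrow> (nat + nat, unit, 'a matrix_rel) binary_structure" where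
  "matrix_structure A =
     \<lparr>universe = matrix_universe A,
      unary_rel = (\<lambda>_. Inl ` {..<dim_row A}),
      binary_rel = matrix_binary_rel A\<rparr>"

section \<open>A word RAM\<close>

text \<open>Programs use registers \<open>Reg 0\<close>, \<open>Reg 1\<close>, ... (each program mentions only finitely many)
  and a random-access memory.  For word size \<open>w\<close> every computed value, in particular every
  address, is reduced modulo \<open>2 ^ w\<close>.  Each constant, register access, memory access and
  arithmetic operation costs one unit, and so does each executed assignment, store and
  branching.\<close>

datatype binop = Plus | Minus | Times | Div | Mod | Less | Equal

datatype expr = Const nat | Reg nat | Load expr | Bin binop expr expr

datatype com =
    Skip
  | Assign nat expr
  | Store expr expr
  | Seq com com
  | If expr com com
  | While expr com

type_synonym state = "(nat \<Rightarrow> nat) \<times> (nat \<Rightarrow> nat)"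

fun binop_val :: "nat \<Rightarrow> binop \<Rightarrow> nat \<Rightarrow> nat \<Rightarrow> nat" where
  "binop_val w Plus a b = (a + b) mod 2 ^ w"
| "binop_val w Minus a b = nat ((int a - int b) mod 2 ^ w)"
| "binop_val w Times a b = (a * b) mod 2 ^ w"
| "binop_val w Div a b = (a div b) mod 2 ^ w"
| "binop_val w Mod a b = (a mod b) mod 2 ^ w"
| "binop_val w Less a b = (if a < b then 1 else 0) mod 2 ^ w"
| "binop_val w Equal a b = (if a = b then 1 else 0) mod 2 ^ w"

fun expr_val :: "nat \<Rightarrow> state \<Rightarrow> expr \<Rightarrow> nat" where
  "expr_val w s (Const c) = c mod 2 ^ w"
| "expr_val w s (Reg r) = fst s r"
| "expr_val w s (Load e) = snd s (expr_val w s e)"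
| "expr_val w s (Bin f e1 e2) = binop_val w f (expr_val w s e1) (expr_val w s e2)"

fun expr_cost :: "expr \<Rightarrow> nat" where
  "expr_cost (Const c) = 1"
| "expr_cost (Reg r) = 1"
| "expr_cost (Load e) = Suc (expr_cost e)"
| "expr_cost (Bin f e1 e2) = Suc (expr_cost e1 + expr_cost e2)"

text \<open>\<open>exec w c s t s'\<close>: on words of \<open>w\<close> bits, \<open>c\<close> started in \<open>s\<close> halts in \<open>s'\<close> after
  \<open>t\<close> units of time.\<close>

inductive exec :: "nat \<Rightarrow> com \<Rightarrow> state \<Rightarrow> nat \<Rightarrow> state \<Rightarrow> bool" for w :: nat where
  Skip: "exec w Skip s 1 s"
| Assign: "exec w (Assign r e) s (Suc (expr_cost e)) ((fst s)(r := expr_val w s e), snd s)"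
| Store: "exec w (Store a e) s (Suc (expr_cost a + expr_cost e))
            (fst s, (snd s)(expr_val w s a := expr_val w s e))"
| Seq: "exec w c1 s t1 s1 \<Longrightarrow> exec w c2 s1 t2 s2 \<Longrightarrow> exec w (Seq c1 c2) s (t1 + t2) s2"
| IfTrue: "expr_val w s e \<noteq> 0 \<Longrightarrow> exec w c1 s t s' \<Longrightarrow>
            exec w (If e c1 c2) s (Suc (expr_cost e + t)) s'"
| IfFalse: "expr_val w s e = 0 \<Longrightarrow> exec w c2 s t s' \<Longrightarrow>
            exec w (If e c1 c2) s (Suc (expr_cost e + t)) s'"
| WhileFalse: "expr_val w s e = 0 \<Longrightarrow> exec w (While e c) s (Suc (expr_cost e)) s"
| WhileTrue: "expr_val w s e \<noteq> 0 \<Longrightarrow> exec w c s t1 s1 \<Longrightarrow> exec w (While e c) s1 t2 s2 \<Longrightarrow>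
            exec w (While e c) s (Suc (expr_cost e + t1 + t2)) s2"

inductive_cases SkipE: "exec w Skip s t s'"
inductive_cases AssignE: "exec w (Assign r e) s t s'"
inductive_cases StoreE: "exec w (Store a e) s t s'"
inductive_cases SeqE: "exec w (Seq c1 c2) s t s'"
inductive_cases IfE: "exec w (If e c1 c2) s t s'"
inductive_cases WhileE: "exec w (While e c) s t s'"

lemma exec_deterministic:
  "exec w c s t s' \<Longrightarrow> exec w c s t' s'' \<Longrightarrow> t = t' \<and> s' = s''"
proof (induction arbitrary: t' s'' rule: exec.induct)
  case (Skip s)
  then show ?case by (rule SkipE) simp
next
  case (Assign r e s)
  then show ?case by (rule AssignE) simp
next
  case (Store a e s)
  then show ?case by (rule StoreE) simp
next
  case (Seq c1 s t1 s1 c2 t2 s2)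
  from Seq.prems show ?case by (rule SeqE) (use Seq.IH in blast)
next
  case (IfTrue s e c1 t s' c2)
  from IfTrue.prems show ?case
    by (rule IfE) (use IfTrue.hyps IfTrue.IH in \<open>(metis less_irrefl)+\<close>)
next
  case (IfFalse s e c2 t s' c1)
  from IfFalse.prems show ?case
    by (rule IfE) (use IfFalse.hyps IfFalse.IH in \<open>(metis less_irrefl)+\<close>)
next
  case (WhileFalse s e c)
  from WhileFalse.prems show ?case
    by (rule WhileE) (use WhileFalse.hyps in \<open>(metis less_irrefl)+\<close>)
next
  case (WhileTrue s e c t1 s1 t2 s2)
  from WhileTrue.prems show ?case
    by (rule WhileE) (use WhileTrue.hyps WhileTrue.IH in \<open>(metis less_irrefl)+\<close>)
qed

text \<open>Input: \<open>Reg 0\<close> holds \<open>n\<close>, the memory holds the entries of \<open>A\<close> and then those of \<open>B\<close>,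
  in row-major order and encoded as numbers; everything else is \<open>0\<close>.
  Output: the entries of the product, in row-major order, in the next \<open>n * n\<close> memory cells.\<close>

definition input_state :: "('a \<Rightarrow> nat) \<Rightarrow> nat \<Rightarrow> 'a mat \<Rightarrow> 'a mat \<Rightarrow> state" where
  "input_state enc n A B =
     ((\<lambda>_. 0)(0 := n),
      (\<lambda>a. if a < n * n then enc (A $$ (a div n, a mod n))
           else if a < 2 * (n * n) then enc (B $$ ((a - n * n) div n, (a - n * n) mod n))
           else 0))"

definition output_is :: "('a \<Rightarrow> nat) \<Rightarrow> nat \<Rightarrow> 'a mat \<Rightarrow> state \<Rightarrow> bool" where
  "output_is enc n C s \<longleftrightarrow>
     (\<forall>i<n. \<forall>j<n. snd s (2 * (n * n) + i * n + j) = enc (C $$ (i, j)))"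

text \<open>Words have at least \<open>k * log 2 (n + 2)\<close> bits, for a constant \<open>k\<close>, and the time bound has
  to hold for all such word sizes.\<close>

definition multiplies_within ::
  "('a::semiring_0 mat \<Rightarrow> bool) \<Rightarrow> ('a \<Rightarrow> nat) \<Rightarrow> nat \<Rightarrow> (nat \<Rightarrow> nat) \<Rightarrow> com \<Rightarrow> bool" where
  "multiplies_within admissible enc k T prog \<longleftrightarrow>
     (\<forall>n. \<forall>A \<in> carrier_mat n n. \<forall>B \<in> carrier_mat n n. admissible A \<longrightarrow> admissible B \<longrightarrow>
       (\<forall>w. real k * log 2 (real n + 2) \<le> real w \<longrightarrow>
         (\<exists>t s. exec w prog (input_state enc n A B) t s \<and> t \<le> T n \<and>
                output_is enc n (A * B) s)))"

end

theory Submission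
  imports Defs "HOL-Library.Disjoint_Sets" "HOL-Library.FuncSet" "HOL-Library.Cardinality"
begin

text \<open>In a matrix of twin-width at most \<open>d\<close> over a field with \<open>q\<close> elements, the rows have at most
  \<open>c k\<close> distinct restrictions to any \<open>k\<close> columns, with \<open>c = (d + 2) q\<^sup>d\<^sup>+\<^sup>1\<close>, and likewise for
  columns.  Arrange the inner index \<open>k\<close> of the product along a binary tree.  At each node, group the
  rows of \<open>A\<close> and the columns of \<open>B\<close> by their restriction to the leaves below, and tabulate the
  inner products of the classes from the tables of the two children.  In a heap the node \<open>p\<close> has at
  most \<open>2 n / p\<close> leaves, hence at most \<open>4 c n / p\<close> classes, and the tables take time
  \<open>O(n\<^sup>2 (1 + \<Sum>p. 1 / p\<^sup>2)) = O(n\<^sup>2)\<close>.  The root table contains the product.  No contraction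
  sequence has to be computed.\<close>

section \<open>Linear neighbourhood complexity\<close>

text \<open>The obstacle is that no contraction sequence is given, so none can guide the
  computation. The program therefore does not depend on \<open>d\<close> and multiplies arbitrary
  matrices correctly; twin-width enters only the time analysis, through the number of classes in
  \<open>class_count_le\<close>. The two summands of the time bound have separate sources. Each of
  the \<open>n - 1\<close> inner nodes scans all \<open>2 * n\<close> vectors, which is quadratic in
  total provided that a vector takes constant time. For this the pair of its classes at the two
  children serves directly as an address, at the price of \<open>S ^ 3\<close> initially zero cells
  and of words long enough to address them. After that a node performs one field addition per pair
  of its classes; since the number of classes is linear in the number of leaves, the squares of
  these numbers sum to O(n^2). Field operations are lookups in tables whose entries are constants of
  the program.\<close>

lemma merge_step_partition_on:
  assumes "partition_on D P" "merge_step P P'"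
  shows "partition_on D P'"
proof -
  obtain X Y where XY: "X \<in> P" "Y \<in> P" "X \<noteq> Y" "P' = insert (X \<union> Y) (P - {X, Y})"
    using assms(2) unfolding merge_step_def by blast
  have dis: "\<And>A B. A \<in> P \<Longrightarrow> B \<in> P \<Longrightarrow> A \<noteq> B \<Longrightarrow> A \<inter> B = {}"
    and un: "\<Union>P = D" and ne: "{} \<notin> P"
    using assms(1) unfolding partition_on_def disjoint_def by blast+
  show ?thesis
  proof (rule partition_onI)
    show "\<Union>P' = D" using XY un by auto
    show "{} \<notin> P'" using XY ne by auto
    show "disjnt A B" if "A \<in> P'" "B \<in> P'" "A \<noteq> B" for A B
    proof -
      have "X \<inter> Z = {}" "Y \<inter> Z = {}" if "Z \<in> P - {X, Y}" for Z
        using dis[of X Z] dis[of Y Z] XY that by auto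
      then show ?thesis using that XY dis[of A B] unfolding disjnt_def by auto
    qed
  qed
qed

lemma contraction_sequence_partition_on:
  assumes "contraction_sequence D Ps" "i < length Ps"
  shows "partition_on D (Ps ! i)"
  using assms(2)
proof (induction i)
  case 0
  have "Ps ! 0 = (\<lambda>x. {x}) ` D"
    using assms(1) hd_conv_nth unfolding contraction_sequence_def by metis
  then show ?case by (auto simp: partition_on_def disjoint_def)
next
  case (Suc i)
  then show ?case
    using assms(1) merge_step_partition_on unfolding contraction_sequence_def
    by (metis Suc_lessD)
qed

lemma ex_merge_sequence:
  assumes "finite D" "D \<noteq> {}" "partition_on D P"
  shows "\<exists>Ps. Ps \<noteq> [] \<and> hd Ps = P \<and> last Ps = {D} \<and>
    (\<forall>i. Suc i < length Ps \<longrightarrow> merge_step (Ps ! i) (Ps ! Suc i))"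
  using assms(3)
proof (induction "card P" arbitrary: P rule: less_induct)
  case less
  have fin: "finite P" using finite_elements[OF assms(1) less.prems] .
  show ?case
  proof (cases "\<exists>X\<in>P. \<exists>Y\<in>P. X \<noteq> Y")
    case True
    then obtain X Y where XY: "X \<in> P" "Y \<in> P" "X \<noteq> Y" by blast
    define P' where "P' = insert (X \<union> Y) (P - {X, Y})"
    have step: "merge_step P P'" using XY P'_def unfolding merge_step_def by blast
    have "card (P - {X, Y}) = card P - 2" using XY fin by (simp add: card_Diff_subset)
    moreover have "card P \<ge> 2"
      using card_mono[OF fin, of "{X, Y}"] XY by simp
    moreover have "card P' \<le> Suc (card (P - {X, Y}))"
      unfolding P'_def using fin by (simp add: card_insert_if)
    ultimately have "card P' < card P" by linarith
    from less.hyps[OF this merge_step_partition_on[OF less.prems step]]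
    obtain Ps where Ps: "Ps \<noteq> []" "hd Ps = P'" "last Ps = {D}"
      "\<forall>i. Suc i < length Ps \<longrightarrow> merge_step (Ps ! i) (Ps ! Suc i)" by blast
    have "merge_step ((P # Ps) ! i) ((P # Ps) ! Suc i)" if "Suc i < length (P # Ps)" for i
      using that Ps step by (cases i) (auto simp: hd_conv_nth)
    then have "P # Ps \<noteq> [] \<and> hd (P # Ps) = P \<and> last (P # Ps) = {D} \<and>
      (\<forall>i. Suc i < length (P # Ps) \<longrightarrow> merge_step ((P # Ps) ! i) ((P # Ps) ! Suc i))"
      using Ps by simp
    then show ?thesis by blast
  next
    case False
    have "\<Union>P = D" using less.prems unfolding partition_on_def by blast
    then obtain X where "X \<in> P" using assms(2) by blast
    then have "P = {X}" using False by blast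
    with \<open>\<Union>P = D\<close> have "P = {D}" by simp
    then show ?thesis by (intro exI[of _ "[P]"]) simp
  qed
qed

text \<open>The \<open>LEAST\<close> in \<open>twin_width\<close> is attained: merging arbitrary
  parts yields some contraction sequence, and the number of red neighbours never exceeds the number
  of subsets of the universe.\<close>

lemma twin_width_le_imp:
  assumes "finite (universe S)" "universe S \<noteq> {}" "twin_width S \<le> d"
  obtains Ps where "contraction_sequence (universe S) Ps"
    "\<And>P X. P \<in> set Ps \<Longrightarrow> X \<in> P \<Longrightarrow> card {Y \<in> P. red_adjacent S X Y} \<le> d"
proof -
  let ?Q = "\<lambda>d. \<exists>Ps. contraction_sequence (universe S) Ps \<and>
     (\<forall>P\<in>set Ps. \<forall>X\<in>P. card {Y \<in> P. red_adjacent S X Y} \<le> d)"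
  have part: "partition_on (universe S) ((\<lambda>x. {x}) ` universe S)"
    by (auto simp: partition_on_def disjoint_def)
  obtain Ps where Ps: "contraction_sequence (universe S) Ps"
    using ex_merge_sequence[OF assms(1,2) part] unfolding contraction_sequence_def by blast
  have "card {Y \<in> P. red_adjacent S X Y} \<le> card (Pow (universe S))" if "P \<in> set Ps" for P X
  proof (rule card_mono)
    show "finite (Pow (universe S))" using assms(1) by simp
    have "partition_on (universe S) P"
      using that contraction_sequence_partition_on[OF Ps] by (metis in_set_conv_nth)
    then show "{Y \<in> P. red_adjacent S X Y} \<subseteq> Pow (universe S)"
      unfolding partition_on_def by blast
  qed
  then have "?Q (card (Pow (universe S)))" using Ps by blast
  then have "?Q (LEAST d. ?Q d)" by (rule LeastI)
  then show ?thesis using that assms(3) unfolding twin_width_def by (meson le_trans)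
qed

text \<open>Consider the last partition all of whose parts meet \<open>X\<close> in at most one element.  Two elements
  of \<open>Y\<close> in the same part differ only at elements of \<open>X\<close> in that part or in its red neighbours, so
  a part contains boundedly many elements of \<open>Y\<close>.  The next merge puts some \<open>x, x'\<close> into one part
  \<open>P\<close>, and only elements of \<open>Y\<close> in \<open>P\<close> or its red neighbours tell \<open>x\<close> and \<open>x'\<close> apart; after
  deleting those, \<open>x'\<close> is redundant.\<close>

lemma neighbourhood_complexity:
  fixes f :: "'v \<Rightarrow> 'v \<Rightarrow> 'a::finite"
  assumes seq: "contraction_sequence D Ps"
    and width: "\<And>P X. P \<in> set Ps \<Longrightarrow> X \<in> P \<Longrightarrow> card {Y \<in> P. red_adjacent S X Y} \<le> d"
    and D: "finite D" "X \<subseteq> D" "Y \<subseteq> D" "X \<noteq> {}"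
    and sep: "\<And>x x' y y'. x \<in> X \<Longrightarrow> x' \<in> X \<Longrightarrow> y \<in> Y \<Longrightarrow> y' \<in> Y \<Longrightarrow> f x y \<noteq> f x' y' \<Longrightarrow>
       atomic_type S x y \<noteq> atomic_type S x' y' \<and> atomic_type S y x \<noteq> atomic_type S y' x'"
    and inj: "\<And>y y'. y \<in> Y \<Longrightarrow> y' \<in> Y \<Longrightarrow> (\<forall>x\<in>X. f x y = f x y') \<Longrightarrow> y = y'"
  shows "card Y \<le> (d + 2) * CARD('a) ^ (d + 1) * card X"
  using D(2-4) sep inj
proof (induction "card X" arbitrary: X Y rule: less_induct)
  case (less X Y)
  define N where "N = CARD('a) ^ (d + 1)"
  have N: "N \<ge> CARD('a)" unfolding N_def by (rule self_le_power) (auto simp: Suc_le_eq)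
  have finXY: "finite X" "finite Y" using less.prems D(1) finite_subset by blast+
  show ?case
  proof (cases "\<exists>x\<in>X. \<exists>x'\<in>X. x \<noteq> x'")
    case False
    then obtain x where x: "X = {x}" using less.prems(3) by blast
    have "inj_on (f x) Y" by (rule inj_onI, rule less.prems(5)) (use x in auto)
    then have "card Y \<le> CARD('a)" by (rule card_inj_on_le) auto
    also have "\<dots> \<le> (d + 2) * N" using N by simp
    finally show ?thesis using x N_def by simp
  next
    case True
    let ?C = "\<lambda>i. i < length Ps \<and> (\<exists>P\<in>Ps ! i. \<exists>x\<in>P \<inter> X. \<exists>x'\<in>P \<inter> X. x \<noteq> x')"
    have Ps: "Ps \<noteq> []" "Ps ! 0 = (\<lambda>x. {x}) ` D" "Ps ! (length Ps - 1) = {D}"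
      "\<And>i. Suc i < length Ps \<Longrightarrow> merge_step (Ps ! i) (Ps ! Suc i)"
      using seq unfolding contraction_sequence_def by (auto simp: hd_conv_nth last_conv_nth)
    have "\<exists>x\<in>D \<inter> X. \<exists>x'\<in>D \<inter> X. x \<noteq> x'" using True less.prems(1) by blast
    then have "?C (length Ps - 1)" using Ps by simp
    then have Ci: "?C (LEAST i. ?C i)" by (rule LeastI)
    have "(LEAST i. ?C i) \<noteq> 0"
    proof
      assume "(LEAST i. ?C i) = 0"
      with Ci have "?C 0" by metis
      then show False using Ps(2) by auto
    qed
    then obtain j where j: "(LEAST i. ?C i) = Suc j" using not0_implies_Suc by blast
    have Cj: "?C (Suc j)" using Ci j by metis
    have "\<not> ?C j" using j not_less_Least[of j ?C] by auto
    then have one: "x = x'" if "P \<in> Ps ! j" "x \<in> P" "x \<in> X" "x' \<in> P" "x' \<in> X" for P x x'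
      using Cj that by auto
    have pj: "partition_on D (Ps ! j)" and psj: "partition_on D (Ps ! Suc j)"
      using contraction_sequence_partition_on[OF seq] Cj by auto
    have fj: "finite (Ps ! j)" "finite (Ps ! Suc j)"
      using finite_elements[OF D(1)] pj psj by auto
    have inset: "Ps ! j \<in> set Ps" "Ps ! Suc j \<in> set Ps" using Cj by auto
    \<comment> \<open>The exponent \<open>d + 1\<close> counts \<open>Q\<close> and its red
      neighbours. Each of these parts holds at most one element of \<open>X\<close>, and an element
      of \<open>Q \<inter> Y\<close> is determined by its values at those elements.\<close>
    have block: "card (Q \<inter> Y) \<le> N" if Q: "Q \<in> Ps ! j" for Q
    proof -
      define Rs where "Rs = insert Q {R \<in> Ps ! j. red_adjacent S Q R}"
      define X' where "X' = X \<inter> \<Union>Rs"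
      have "card Rs \<le> Suc (card {R \<in> Ps ! j. red_adjacent S Q R})"
        unfolding Rs_def using fj by (simp add: card_insert_if)
      then have cR: "card Rs \<le> d + 1" using width[OF inset(1) Q] by simp
      have sub: "Rs \<subseteq> Ps ! j" using Q unfolding Rs_def by blast
      define g where "g x = (SOME R. R \<in> Rs \<and> x \<in> R)" for x
      have g: "g x \<in> Rs \<and> x \<in> g x" if "x \<in> X'" for x
        unfolding g_def by (rule someI_ex) (use that X'_def in blast)
      have "inj_on g X'"
        by (rule inj_onI) (metis (no_types, lifting) IntE X'_def g one sub subsetD)
      then have "card X' \<le> card Rs"
        by (rule card_inj_on_le) (use g sub fj finite_subset in \<open>auto\<close>)
      then have cX': "card X' \<le> d + 1" using cR by simp
      have finX': "finite X'" using finXY X'_def by simp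
      have "inj_on (\<lambda>y. restrict (\<lambda>x. f x y) X') (Q \<inter> Y)"
      proof (rule inj_onI)
        fix y y' assume y: "y \<in> Q \<inter> Y" "y' \<in> Q \<inter> Y"
          and eq: "restrict (\<lambda>x. f x y) X' = restrict (\<lambda>x. f x y') X'"
        show "y = y'"
        proof (rule less.prems(5))
          show "\<forall>x\<in>X. f x y = f x y'"
          proof
            fix x assume x: "x \<in> X"
            show "f x y = f x y'"
            proof (cases "x \<in> X'")
              case True
              then show ?thesis using fun_cong[OF eq, of x] by simp
            next
              case False
              obtain R where R: "R \<in> Ps ! j" "x \<in> R"
                using x less.prems(1) pj unfolding partition_on_def by blast
              then have "\<not> red_adjacent S Q R" "Q \<noteq> R"
                using False x unfolding X'_def Rs_def by auto
              \<comment> \<open>Here the element of \<open>Y\<close> comes first, whereas the bound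
                on \<open>Z\<close> below compares pairs with the element of \<open>X\<close> first.
                This is why \<open>sep\<close> speaks of both orders.\<close>
              then have "atomic_type S y x = atomic_type S y' x"
                using y R unfolding red_adjacent_def by blast
              then show ?thesis using less.prems(4)[OF x x, of y y'] y by blast
            qed
          qed
        qed (use y in auto)
      qed
      then have "card (Q \<inter> Y) \<le> card (X' \<rightarrow>\<^sub>E (UNIV :: 'a set))"
        by (rule card_inj_on_le) (use finX' in \<open>auto intro: finite_PiE\<close>)
      also have "\<dots> = CARD('a) ^ card X'" using finX' by (simp add: card_PiE)
      also have "\<dots> \<le> N" unfolding N_def by (rule power_increasing[OF cX']) (auto simp: Suc_le_eq)
      finally show ?thesis .
    qed
    obtain Q1 Q2 where Q: "Q1 \<in> Ps ! j" "Q2 \<in> Ps ! j"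
      and merge: "Ps ! Suc j = insert (Q1 \<union> Q2) (Ps ! j - {Q1, Q2})"
      using Ps(4)[of j] Cj unfolding merge_step_def by blast
    obtain P x x' where P: "P \<in> Ps ! Suc j" "x \<in> P" "x \<in> X" "x' \<in> P" "x' \<in> X" "x \<noteq> x'"
      using Cj by blast
    have PQ: "P = Q1 \<union> Q2"
    proof (rule ccontr)
      assume "P \<noteq> Q1 \<union> Q2"
      then have "P \<in> Ps ! j" using P(1) merge by auto
      then show False using one P by blast
    qed
    define Z where "Z = {y \<in> Y. f x y \<noteq> f x' y}"
    define Rs where "Rs = {R \<in> Ps ! Suc j. red_adjacent S P R}"
    have cRs: "card Rs \<le> d" unfolding Rs_def by (rule width[OF inset(2) P(1)])
    have finRs: "finite Rs" using fj unfolding Rs_def by simp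
    \<comment> \<open>\<open>P\<close> is the only part created by the merge and
      \<open>red_adjacent\<close> excludes equality, so the red neighbours of \<open>P\<close> are
      old parts and \<open>block\<close> applies to them. With \<open>Q1\<close> and
      \<open>Q2\<close> this makes at most \<open>d + 2\<close> old parts.\<close>
    have Rsj: "R \<in> Ps ! j" if "R \<in> Rs" for R
      using that merge PQ unfolding Rs_def red_adjacent_def by auto
    have "Z \<subseteq> (Q1 \<inter> Y) \<union> (Q2 \<inter> Y) \<union> (\<Union>R\<in>Rs. R \<inter> Y)"
    proof
      fix y assume y: "y \<in> Z"
      then have "y \<in> Y" "f x y \<noteq> f x' y" unfolding Z_def by auto
      then have at: "atomic_type S x y \<noteq> atomic_type S x' y"
        using less.prems(4)[OF P(3,5), of y y] by blast
      obtain R where R: "R \<in> Ps ! Suc j" "y \<in> R"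
        using \<open>y \<in> Y\<close> less.prems(2) psj unfolding partition_on_def by blast
      show "y \<in> (Q1 \<inter> Y) \<union> (Q2 \<inter> Y) \<union> (\<Union>R\<in>Rs. R \<inter> Y)"
      proof (cases "R = P")
        case True
        then show ?thesis using PQ R \<open>y \<in> Y\<close> by auto
      next
        case False
        then have "red_adjacent S P R"
          using at P R unfolding red_adjacent_def by blast
        then show ?thesis using R \<open>y \<in> Y\<close> unfolding Rs_def by auto
      qed
    qed
    then have "card Z \<le> card ((Q1 \<inter> Y) \<union> (Q2 \<inter> Y) \<union> (\<Union>R\<in>Rs. R \<inter> Y))"
      by (rule card_mono[rotated]) (use finRs finXY in auto)
    also have "\<dots> \<le> card (Q1 \<inter> Y) + card (Q2 \<inter> Y) + card (\<Union>R\<in>Rs. R \<inter> Y)"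
      by (meson add_le_mono card_Un_le le_refl le_trans)
    also have "card (\<Union>R\<in>Rs. R \<inter> Y) \<le> (\<Sum>R\<in>Rs. card (R \<inter> Y))"
      using finRs by (rule card_UN_le)
    also have "\<dots> \<le> card Rs * N"
      using sum_bounded_above[of Rs "\<lambda>R. card (R \<inter> Y)" N] block Rsj by simp
    also have "card Rs * N \<le> d * N" using cRs by simp
    finally have cZ: "card Z \<le> (d + 2) * N"
      using block[OF Q(1)] block[OF Q(2)] by (simp add: algebra_simps)
    have "card (Y - Z) \<le> (d + 2) * CARD('a) ^ (d + 1) * card (X - {x'})"
    proof (rule less.hyps)
      show "card (X - {x'}) < card X" using P finXY by (intro psubset_card_mono) auto
      show "X - {x'} \<subseteq> D" "Y - Z \<subseteq> D" "X - {x'} \<noteq> {}" using less.prems P by auto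
      show "atomic_type S u v \<noteq> atomic_type S u' v' \<and> atomic_type S v u \<noteq> atomic_type S v' u'"
        if "u \<in> X - {x'}" "u' \<in> X - {x'}" "v \<in> Y - Z" "v' \<in> Y - Z" "f u v \<noteq> f u' v'"
        for u u' v v'
        using that less.prems(4) by blast
      show "v = v'" if "v \<in> Y - Z" "v' \<in> Y - Z" "\<forall>u\<in>X - {x'}. f u v = f u v'" for v v'
      proof (rule less.prems(5))
        have "f x v = f x' v" "f x v' = f x' v'" using that(1,2) unfolding Z_def by auto
        then show "\<forall>u\<in>X. f u v = f u v'" using that(3) P by (metis DiffI singletonD)
      qed (use that in auto)
    qed
    then have *: "card (Y - Z) \<le> (d + 2) * N * (card X - 1)"
      using P finXY unfolding N_def by simp
    have "card Y \<le> card (Y - Z) + card Z"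
      using card_Un_le[of "Y - Z" Z] finXY
      by (metis (no_types, lifting) Diff_partition Un_commute Z_def mem_Collect_eq subsetI)
    also have "\<dots> \<le> (d + 2) * N * (card X - 1) + (d + 2) * N" using * cZ by simp
    also have "\<dots> = (d + 2) * N * card X"
      using P finXY card_gt_0_iff[of X] by (cases "card X") (auto simp: algebra_simps)
    finally show ?thesis unfolding N_def .
  qed
qed

section \<open>Distinct restricted rows and columns of a matrix\<close>

context
  fixes A :: "'a::finite mat" and n d :: nat
  assumes A: "A \<in> carrier_mat n n" and tw: "twin_width (matrix_structure A) \<le> d"
begin

text \<open>Symmetric in its arguments, so that \<open>neighbourhood_complexity\<close> can be used
  both with columns and with rows in the role of \<open>X\<close>.\<close>

private fun entry :: "nat + nat \<Rightarrow> nat + nat \<Rightarrow> 'a" where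
  "entry (Inl i) (Inr j) = A $$ (i, j)"
| "entry (Inr j) (Inl i) = A $$ (i, j)"
| "entry x y = undefined"

text \<open>The relation \<open>Entry (A $$ (i, j))\<close> tells the two pairs apart. It runs from
  rows to columns, so it shows in the third component of the atomic type in one order and in the
  fourth in the other.\<close>

private lemma entry_sep:
  assumes "x \<in> Inl ` {..<n} \<and> x' \<in> Inl ` {..<n} \<and> y \<in> Inr ` {..<n} \<and> y' \<in> Inr ` {..<n}"
    and "entry x y \<noteq> entry x' y'"
  shows "atomic_type (matrix_structure A) x y \<noteq> atomic_type (matrix_structure A) x' y'"
    "atomic_type (matrix_structure A) y x \<noteq> atomic_type (matrix_structure A) y' x'"
proof -
  obtain i i' j j' where ij: "x = Inl i" "x' = Inl i'" "y = Inr j" "y' = Inr j'"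
    "i < n" "i' < n" "j < n" "j' < n" using assms by auto
  have "(Inl i, Inr j) \<in> binary_rel (matrix_structure A) (Entry (A $$ (i, j)))"
    "(Inl i', Inr j') \<notin> binary_rel (matrix_structure A) (Entry (A $$ (i, j)))"
    using ij assms(2) A by (auto simp: matrix_structure_def)
  then show "atomic_type (matrix_structure A) x y \<noteq> atomic_type (matrix_structure A) x' y'"
    "atomic_type (matrix_structure A) y x \<noteq> atomic_type (matrix_structure A) y' x'"
    unfolding atomic_type_def ij by blast+
qed

lemma card_distinct_rows_cols_le:
  assumes "K \<subseteq> {..<n}" "K \<noteq> {}" "I \<subseteq> {..<n}"
  shows "(\<And>i i'. i \<in> I \<Longrightarrow> i' \<in> I \<Longrightarrow> \<forall>k\<in>K. A $$ (i, k) = A $$ (i', k) \<Longrightarrow> i = i') \<Longrightarrow>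
      card I \<le> (d + 2) * CARD('a) ^ (d + 1) * card K"
    and "(\<And>i i'. i \<in> I \<Longrightarrow> i' \<in> I \<Longrightarrow> \<forall>k\<in>K. A $$ (k, i) = A $$ (k, i') \<Longrightarrow> i = i') \<Longrightarrow>
      card I \<le> (d + 2) * CARD('a) ^ (d + 1) * card K"
proof -
  let ?S = "matrix_structure A"
  have univ: "universe ?S = {..<n} <+> {..<n}"
    using A by (simp add: matrix_structure_def matrix_universe_def)
  \<comment> \<open>A nonempty \<open>K\<close> forces \<open>0 < n\<close>; for an empty matrix
    \<open>twin_width\<close> would be unspecified.\<close>
  have "finite (universe ?S)" "universe ?S \<noteq> {}" using assms univ by auto
  then obtain Ps where Ps: "contraction_sequence (universe ?S) Ps"
    "\<And>P X. P \<in> set Ps \<Longrightarrow> X \<in> P \<Longrightarrow> card {Y \<in> P. red_adjacent ?S X Y} \<le> d"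
    using tw by (rule twin_width_le_imp) blast
  note nc = neighbourhood_complexity[OF Ps, of _ _ entry, simplified univ]
  have cI: "card (Inl ` I :: (nat + nat) set) = card I" "card (Inr ` I :: (nat + nat) set) = card I"
    "card (Inl ` K :: (nat + nat) set) = card K" "card (Inr ` K :: (nat + nat) set) = card K"
    by (simp_all add: card_image)
  {
    assume inj: "\<And>i i'. i \<in> I \<Longrightarrow> i' \<in> I \<Longrightarrow> \<forall>k\<in>K. A $$ (i, k) = A $$ (i', k) \<Longrightarrow> i = i'"
    have "card (Inl ` I :: (nat + nat) set)
        \<le> (d + 2) * CARD('a) ^ (d + 1) * card (Inr ` K :: (nat + nat) set)"
    proof (rule nc)
      show "atomic_type ?S x y \<noteq> atomic_type ?S x' y' \<and> atomic_type ?S y x \<noteq> atomic_type ?S y' x'"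
        if "x \<in> Inr ` K" "x' \<in> Inr ` K" "y \<in> Inl ` I" "y' \<in> Inl ` I" "entry x y \<noteq> entry x' y'"
        for x x' y y'
      proof -
        have *: "y \<in> Inl ` {..<n} \<and> y' \<in> Inl ` {..<n} \<and> x \<in> Inr ` {..<n} \<and> x' \<in> Inr ` {..<n}"
          using that assms by blast
        have "entry y x \<noteq> entry y' x'" using that by auto
        from entry_sep[OF * this] show ?thesis by blast
      qed
    qed (use assms inj in \<open>auto simp: Plus_def\<close>)
    then show "card I \<le> (d + 2) * CARD('a) ^ (d + 1) * card K" unfolding cI .
  next
    assume inj: "\<And>i i'. i \<in> I \<Longrightarrow> i' \<in> I \<Longrightarrow> \<forall>k\<in>K. A $$ (k, i) = A $$ (k, i') \<Longrightarrow> i = i'"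
    have "card (Inr ` I :: (nat + nat) set)
        \<le> (d + 2) * CARD('a) ^ (d + 1) * card (Inl ` K :: (nat + nat) set)"
    proof (rule nc)
      show "atomic_type ?S x y \<noteq> atomic_type ?S x' y' \<and> atomic_type ?S y x \<noteq> atomic_type ?S y' x'"
        if "x \<in> Inl ` K" "x' \<in> Inl ` K" "y \<in> Inr ` I" "y' \<in> Inr ` I" "entry x y \<noteq> entry x' y'"
        for x x' y y'
      proof -
        have *: "x \<in> Inl ` {..<n} \<and> x' \<in> Inl ` {..<n} \<and> y \<in> Inr ` {..<n} \<and> y' \<in> Inr ` {..<n}"
          using that assms by blast
        from entry_sep[OF * that(5)] show ?thesis by blast
      qed
    qed (use assms inj in \<open>auto simp: Plus_def\<close>)
    then show "card I \<le> (d + 2) * CARD('a) ^ (d + 1) * card K" unfolding cI .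
  }
qed

end

section \<open>Reasoning about word RAM programs\<close>

text \<open>Total correctness with time: the postcondition receives the exact cost, so costs compose
  by shifting its first argument.\<close>

definition wp :: "nat \<Rightarrow> com \<Rightarrow> state \<Rightarrow> (nat \<Rightarrow> state \<Rightarrow> bool) \<Rightarrow> bool" where
  "wp w c s Q \<longleftrightarrow> (\<exists>t s'. exec w c s t s' \<and> Q t s')"

lemma wp_Skip: "Q 1 s \<Longrightarrow> wp w Skip s Q"
  unfolding wp_def using exec.Skip by blast

lemma wp_Assign: "Q (Suc (expr_cost e)) ((fst s)(r := expr_val w s e), snd s) \<Longrightarrow> wp w (Assign r e) s Q"
  unfolding wp_def using exec.Assign by blast

lemma wp_Store:
  "Q (Suc (expr_cost a + expr_cost e)) (fst s, (snd s)(expr_val w s a := expr_val w s e)) \<Longrightarrow>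
    wp w (Store a e) s Q"
  unfolding wp_def using exec.Store by blast

text \<open>The value is a separate premise, so that symbolic execution puts a named mathematical
  value into the state instead of an unevaluated expression.\<close>

lemma wp_Assign_val:
  "expr_val w (R, M) e = v \<Longrightarrow> Q (Suc (expr_cost e)) (R(r := v), M) \<Longrightarrow> wp w (Assign r e) (R, M) Q"
  by (simp add: wp_Assign)

lemma wp_Store_val:
  "expr_val w (R, M) a = x \<Longrightarrow> expr_val w (R, M) e = v \<Longrightarrow>
    Q (Suc (expr_cost a + expr_cost e)) (R, M(x := v)) \<Longrightarrow> wp w (Store a e) (R, M) Q"
  by (simp add: wp_Store)

lemma wp_Seq: "wp w c1 s (\<lambda>t1 s1. wp w c2 s1 (\<lambda>t2. Q (t1 + t2))) \<Longrightarrow> wp w (Seq c1 c2) s Q"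
  unfolding wp_def using exec.Seq by blast

lemma wp_If:
  assumes "expr_val w s e \<noteq> 0 \<Longrightarrow> wp w c1 s (\<lambda>t. Q (Suc (expr_cost e + t)))"
    and "expr_val w s e = 0 \<Longrightarrow> wp w c2 s (\<lambda>t. Q (Suc (expr_cost e + t)))"
  shows "wp w (If e c1 c2) s Q"
proof (cases "expr_val w s e = 0")
  case True
  then show ?thesis using assms(2) exec.IfFalse unfolding wp_def by blast
next
  case False
  then show ?thesis using assms(1) exec.IfTrue unfolding wp_def by blast
qed

lemma wp_mono: "wp w c s Q \<Longrightarrow> (\<And>t s'. Q t s' \<Longrightarrow> Q' t s') \<Longrightarrow> wp w c s Q'"
  unfolding wp_def by blast

text \<open>Fixing the number \<open>m\<close> of iterations beforehand replaces a termination
  argument; the induction runs downward from \<open>m\<close>. The guard is paid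
  \<open>m + 1\<close> times, hence the extra summand.\<close>

lemma wp_While:
  assumes body: "\<And>i s. i < m \<Longrightarrow> I i s \<Longrightarrow>
      expr_val w s e \<noteq> 0 \<and> wp w c s (\<lambda>t s'. t \<le> f i \<and> I (Suc i) s')"
    and stop: "\<And>s. I m s \<Longrightarrow> expr_val w s e = 0"
    and init: "I 0 s"
  shows "wp w (While e c) s
    (\<lambda>t s'. t \<le> (\<Sum>i<m. f i + Suc (expr_cost e)) + Suc (expr_cost e) \<and> I m s')"
proof -
  have "wp w (While e c) s
      (\<lambda>t s'. t \<le> (\<Sum>i=j..<m. f i + Suc (expr_cost e)) + Suc (expr_cost e) \<and> I m s')"
    if "I j s" "j \<le> m" for j s
    using that(2,1)
  proof (induction j arbitrary: s rule: inc_induct)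
    case base
    then show ?case using exec.WhileFalse[of w s e c] stop unfolding wp_def by fastforce
  next
    case (step j)
    obtain t1 s1 where 1: "expr_val w s e \<noteq> 0" "exec w c s t1 s1" "t1 \<le> f j" "I (Suc j) s1"
      using body[OF step.hyps(2) step.prems] unfolding wp_def by blast
    obtain t2 s2 where 2: "exec w (While e c) s1 t2 s2" "I m s2"
      "t2 \<le> (\<Sum>i=Suc j..<m. f i + Suc (expr_cost e)) + Suc (expr_cost e)"
      using step.IH[OF 1(4)] unfolding wp_def by blast
    have "exec w (While e c) s (Suc (expr_cost e + t1 + t2)) s2"
      using 1 2 by (intro exec.WhileTrue)
    moreover have "Suc (expr_cost e + t1 + t2)
        \<le> (\<Sum>i=j..<m. f i + Suc (expr_cost e)) + Suc (expr_cost e)"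
      using 1(3) 2(3) step.hyps(2) by (simp add: sum.atLeast_Suc_lessThan)
    ultimately show ?case using 2(2) unfolding wp_def by blast
  qed
  from this[of 0 s] init show ?thesis by (simp add: atLeast0LessThan)
qed

section \<open>Tagged addresses and arithmetic without overflow\<close>

definition addr :: "nat \<Rightarrow> nat \<Rightarrow> nat \<Rightarrow> nat \<Rightarrow> nat \<Rightarrow> nat" where
  "addr S t a b c = ((t * S + a) * S + b) * S + c"

lemma radix_eq_iff:
  fixes a b c d S :: nat
  assumes "b < S" "d < S"
  shows "a * S + b = c * S + d \<longleftrightarrow> a = c \<and> b = d"
proof
  assume eq: "a * S + b = c * S + d"
  have "(a * S + b) div S = a" "(c * S + d) div S = c" using assms by simp_all
  then have "a = c" using eq by metis
  then show "a = c \<and> b = d" using eq by simp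
qed simp

text \<open>\<open>a\<close>, \<open>b\<close>, \<open>c\<close> are the lower digits in base
  \<open>S\<close> and \<open>t\<close> is an unbounded leading part, so tag \<open>t\<close> owns
  the cells from \<open>t * S ^ 3\<close> up to \<open>Suc t * S ^ 3\<close>.\<close>

lemma addr_eq_iff:
  assumes "a < S" "b < S" "c < S" "a' < S" "b' < S" "c' < S"
  shows "addr S t a b c = addr S t' a' b' c' \<longleftrightarrow> t = t' \<and> a = a' \<and> b = b' \<and> c = c'"
  unfolding addr_def using assms by (simp add: radix_eq_iff)

lemma addr_ge: "t * S ^ 3 \<le> addr S t a b c"
  unfolding addr_def by (simp add: algebra_simps power3_eq_cube)

lemma addr_less:
  assumes "a < S" "b < S" "c < S"
  shows "addr S t a b c < Suc t * S ^ 3"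
proof -
  have "t * S + a < Suc t * S" using assms by simp
  then have "Suc (t * S + a) * S \<le> Suc t * S * S" by (intro mult_right_mono) auto
  then have "(t * S + a) * S + b < Suc t * S * S" using assms by simp
  then have "Suc ((t * S + a) * S + b) * S \<le> Suc t * S * S * S" by (intro mult_right_mono) auto
  then show ?thesis unfolding addr_def using assms by (simp add: power3_eq_cube algebra_simps)
qed

definition addr_expr :: "nat \<Rightarrow> expr \<Rightarrow> expr \<Rightarrow> expr \<Rightarrow> expr" where
  "addr_expr t a b c =
    Bin Plus (Bin Times (Bin Plus (Bin Times (Bin Plus (Bin Times (Const t) (Reg 1)) a)
      (Reg 1)) b) (Reg 1)) c"

lemma expr_cost_addr_expr:
  "expr_cost (addr_expr t a b c) = 10 + (expr_cost a + expr_cost b + expr_cost c)"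
  by (simp add: addr_expr_def)

fun store_list :: "(nat \<times> nat \<times> nat) list \<Rightarrow> com" where
  "store_list [] = Skip"
| "store_list ((a, b, v) # xs) =
    Seq (Store (addr_expr 2 (Reg 2) (Const a) (Const b)) (Const v)) (store_list xs)"

text \<open>The field operation is compiled into \<open>q * q\<close> constant stores. The node is
  read from register 2, so the same scheme serves node 0 and every leaf.\<close>

definition store_table :: "nat \<Rightarrow> (nat \<Rightarrow> nat \<Rightarrow> nat) \<Rightarrow> com" where
  "store_table q f = store_list (map (\<lambda>(a, b). (a, b, f a b)) (List.product [0..<q] [0..<q]))"

text \<open>Tags are at most 5, so by \<open>addr_less\<close> every address is below
  \<open>6 * S ^ 3\<close> and is not altered by reduction modulo \<open>2 ^ w\<close>.\<close>

locale word_bound =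
  fixes w S :: nat
  assumes S2: "2 \<le> S" and bound: "6 * S ^ 3 \<le> 2 ^ w"
begin

lemma w_pos: "0 < w"
  using S2 bound power_mono[of 2 S 3] by (cases w) auto

lemma S_squared_le: "6 * (S * S) \<le> 2 ^ w"
proof -
  have "6 * (S * S) * 1 \<le> 6 * (S * S) * S" using S2 by (intro mult_left_mono) auto
  also have "\<dots> = 6 * S ^ 3" by (simp add: power3_eq_cube)
  also have "\<dots> \<le> 2 ^ w" by (rule bound)
  finally show ?thesis by simp
qed

lemma S_le: "12 * S \<le> 2 ^ w"
proof -
  have "2 * S \<le> S * S" using S2 by (rule mult_right_mono) simp
  then show ?thesis using S_squared_le by linarith
qed

lemma less_bound: "20 \<le> (2::nat) ^ w" using S_le S2 by linarith

lemma binop_Plus: "a + b < 2 ^ w \<Longrightarrow> binop_val w Plus a b = a + b"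
  by simp

lemma binop_Times: "a * b < 2 ^ w \<Longrightarrow> binop_val w Times a b = a * b"
  by simp

lemma binop_Minus: "b \<le> a \<Longrightarrow> a < 2 ^ w \<Longrightarrow> binop_val w Minus a b = a - b"
proof -
  assume a: "b \<le> a" "a < 2 ^ w"
  have "int a - int b < 2 ^ w" using a(2) by (metis diff_le_self le_less_trans a(1) of_nat_diff
    of_nat_less_iff of_nat_numeral of_nat_power)
  then have "(int a - int b) mod 2 ^ w = int a - int b" using a(1) by (intro mod_pos_pos_trivial) auto
  then show ?thesis using a(1) by simp
qed

lemma binop_Div: "a < 2 ^ w \<Longrightarrow> binop_val w Div a b = a div b"
  using le_less_trans[OF div_le_dividend] by simp

lemma binop_Mod: "a < 2 ^ w \<Longrightarrow> binop_val w Mod a b = a mod b"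
  using le_less_trans[OF mod_less_eq_dividend] by simp

lemma binop_Less: "binop_val w Less a b = (if a < b then 1 else 0)"
  using w_pos by (cases w) auto

lemma Const_val: "c < 2 ^ w \<Longrightarrow> expr_val w s (Const c) = c"
  by simp

text \<open>Each operation reduces modulo \<open>2 ^ w\<close>, and reduction is compatible with
  sums and products; hence it suffices that the final address fits into a word.\<close>

lemma addr_expr_val:
  assumes "fst s 1 = S" "t \<le> 5"
    and "expr_val w s a < S" "expr_val w s b < S" "expr_val w s c < S"
  shows "expr_val w s (addr_expr t a b c)
    = addr S t (expr_val w s a) (expr_val w s b) (expr_val w s c)"
proof -
  have "addr S t (expr_val w s a) (expr_val w s b) (expr_val w s c) < Suc t * S ^ 3"
    using addr_less assms by blast
  also have "\<dots> \<le> 6 * S ^ 3" using assms(2) by (intro mult_right_mono) auto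
  also have "\<dots> \<le> 2 ^ w" by (rule bound)
  finally show ?thesis
    using assms(1) unfolding addr_expr_def addr_def
    by (simp add: mod_add_left_eq mod_add_right_eq mod_mult_left_eq mod_mult_right_eq mod_simps)
qed

lemmas no_overflow = binop_Plus binop_Times binop_Minus binop_Div binop_Mod binop_Less
  Const_val addr_expr_val

lemma wp_store_list:
  assumes "R 1 = S" "R 2 < S"
    and "\<And>a b v. (a, b, v) \<in> set xs \<Longrightarrow> a < S \<and> b < S \<and> v < S \<and> v = f a b"
  shows "wp w (store_list xs) (R, M) (\<lambda>t s'. t = Suc (15 * length xs) \<and> fst s' = R \<and>
    (\<forall>(a, b, v) \<in> set xs. snd s' (addr S 2 (R 2) a b) = v) \<and>
    (\<forall>x. (\<forall>(a, b, v) \<in> set xs. x \<noteq> addr S 2 (R 2) a b) \<longrightarrow> snd s' x = M x))"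
  using assms(3)
proof (induction xs arbitrary: M)
  case Nil
  then show ?case by (auto intro!: wp_Skip)
next
  case (Cons y xs)
  obtain a b v where y: "y = (a, b, v)" by (cases y) auto
  have abv: "a < S" "b < S" "v < S" "v = f a b" using Cons.prems[of a b v] y by auto
  have lt: "a < 2 ^ w" "b < 2 ^ w" "v < 2 ^ w" using abv S_le by linarith+
  let ?x = "addr S 2 (R 2) a b"
  have val: "expr_val w (R, M) (addr_expr 2 (Reg 2) (Const a) (Const b)) = ?x"
    using assms(1,2) abv lt by (simp add: addr_expr_val)
  have IH: "wp w (store_list xs) (R, M(?x := v)) (\<lambda>t s'. t = Suc (15 * length xs) \<and> fst s' = R \<and>
    (\<forall>(a, b, v) \<in> set xs. snd s' (addr S 2 (R 2) a b) = v) \<and>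
    (\<forall>x. (\<forall>(a, b, v) \<in> set xs. x \<noteq> addr S 2 (R 2) a b) \<longrightarrow> snd s' x = (M(?x := v)) x))"
    by (rule Cons.IH, rule Cons.prems) simp
  \<comment> \<open>A later list element may write to the same cell; all values come from one
    function \<open>f\<close> of the key, so the overwriting value is the same.\<close>
  have head: "snd s' ?x = v"
    if 1: "\<forall>(a, b, v) \<in> set xs. snd s' (addr S 2 (R 2) a b) = v"
      and 2: "\<forall>x. (\<forall>(a, b, v) \<in> set xs. x \<noteq> addr S 2 (R 2) a b) \<longrightarrow> snd s' x = (M(?x := v)) x"
    for s' :: state
  proof (cases "\<forall>(a', b', v') \<in> set xs. ?x \<noteq> addr S 2 (R 2) a' b'")
    case True
    then show ?thesis using 2 by simp
  next
    case False
    then obtain a' b' v' where in_xs: "(a', b', v') \<in> set xs" and eq: "?x = addr S 2 (R 2) a' b'"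
      by auto
    have ab': "a' < S" "b' < S" "v' = f a' b'" using Cons.prems[of a' b' v'] in_xs by auto
    have "a = a'" "b = b'"
      using eq abv ab' assms(2) by (auto simp: addr_eq_iff)
    moreover have "snd s' ?x = v'" using 1 in_xs eq by auto
    ultimately show ?thesis using abv(4) ab'(3) by simp
  qed
  show ?case
    unfolding y store_list.simps
    apply (rule wp_Seq, rule wp_Store)
    apply (simp only: fst_conv snd_conv val Const_val[OF lt(3)])
    apply (rule wp_mono[OF IH])
    using head by (auto simp: expr_cost_addr_expr)
qed

lemma wp_store_table:
  assumes "R 1 = S" "R 2 < S" "q \<le> S" "\<And>a b. a < q \<Longrightarrow> b < q \<Longrightarrow> f a b < S"
  shows "wp w (store_table q f) (R, M) (\<lambda>t s'. t = Suc (15 * (q * q)) \<and> fst s' = R \<and>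
    (\<forall>a<q. \<forall>b<q. snd s' (addr S 2 (R 2) a b) = f a b) \<and>
    (\<forall>x. (\<forall>a<S. \<forall>b<S. x \<noteq> addr S 2 (R 2) a b) \<longrightarrow> snd s' x = M x))"
  unfolding store_table_def
  by (rule wp_mono[OF wp_store_list[where f = f]]) (use assms in \<open>auto\<close>)

end

section \<open>The multiplication program\<close>

abbreviation "double_n \<equiv> Bin Plus (Reg 0) (Reg 0)"
abbreviation "square_n \<equiv> Bin Times (Reg 0) (Reg 0)"
abbreviation "left \<equiv> Bin Plus (Reg 2) (Reg 2)"
abbreviation "right \<equiv> Bin Plus (Bin Plus (Reg 2) (Reg 2)) (Const 1)"
abbreviation "incr r \<equiv> Assign r (Bin Plus (Reg r) (Const 1))"

text \<open>Register 1 holds the radix \<open>S = 2 n + q\<close> of the addresses.  The tag of an address says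
  which table it belongs to: 2 for the inner products of classes at a node (node 0, which is not in
  the tree, holds the addition table), 3 for the representatives \<open>rep p i\<close>, 4 for the list of the
  representatives of the current node (register 2), 5 for the hash table that assigns to a pair of
  classes of the two children a class of the node.  The radix makes every tagged address lie above
  the input and output cells, and hash cells are never reset since unwritten memory is \<open>0\<close>;
  therefore they store the successor of the representative.\<close>

definition row_body :: com where
  "row_body =
    Seq (Assign 5 (Load (addr_expr 3 left (Reg 3) (Const 0))))
   (Seq (Assign 6 (Load (addr_expr 3 right (Reg 3) (Const 0))))
   (Seq (Assign 7 (addr_expr 5 (Reg 2) (Reg 5) (Reg 6)))
   (Seq (If (Load (Reg 7)) Skip
          (Seq (Store (Reg 7) (Bin Plus (Reg 3) (Const 1)))
          (Seq (Store (addr_expr 4 (Reg 4) (Const 0) (Const 0)) (Reg 3))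
               (incr 4))))
   (Seq (Store (addr_expr 3 (Reg 2) (Reg 3) (Const 0)) (Bin Minus (Load (Reg 7)) (Const 1)))
        (incr 3)))))"

text \<open>With \<open>c\<close> classes in register 4, the counter \<open>y * c + z\<close> stands
  for the pair of list positions \<open>y\<close>, \<open>z\<close>. The inner products at the two
  children are looked up and added by the table at node 0.\<close>

definition pair_body :: com where
  "pair_body =
    Seq (Assign 5 (Load (addr_expr 4 (Bin Div (Reg 3) (Reg 4)) (Const 0) (Const 0))))
   (Seq (Assign 6 (Load (addr_expr 4 (Bin Mod (Reg 3) (Reg 4)) (Const 0) (Const 0))))
   (Seq (Assign 7 (Load (addr_expr 2 left
          (Load (addr_expr 3 left (Reg 5) (Const 0))) (Load (addr_expr 3 left (Reg 6) (Const 0))))))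
   (Seq (Assign 8 (Load (addr_expr 2 right
          (Load (addr_expr 3 right (Reg 5) (Const 0))) (Load (addr_expr 3 right (Reg 6) (Const 0))))))
   (Seq (Store (addr_expr 2 (Reg 2) (Reg 5) (Reg 6)) (Load (addr_expr 2 (Const 0) (Reg 7) (Reg 8))))
        (incr 3)))))"

definition node_body :: com where
  "node_body =
    Seq (Assign 2 (Bin Minus (Reg 2) (Const 1)))
   (Seq (Assign 4 (Const 0))
   (Seq (Assign 3 (Const 0))
   (Seq (While (Bin Less (Reg 3) double_n) row_body)
   (Seq (Assign 3 (Const 0))
        (While (Bin Less (Reg 3) (Bin Times (Reg 4) (Reg 4))) pair_body)))))"

text \<open>One counter serves both inputs: its quotient and remainder by \<open>n\<close> are
  vector and coordinate in \<open>A\<close>, but coordinate and vector in \<open>B\<close>, so they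
  swap places in the second store.\<close>

definition copy_body :: com where
  "copy_body =
    Seq (Assign 5 (Bin Div (Reg 3) (Reg 0)))
   (Seq (Assign 6 (Bin Mod (Reg 3) (Reg 0)))
   (Seq (Store (addr_expr 3 (Bin Plus (Reg 0) (Reg 6)) (Reg 5) (Const 0)) (Load (Reg 3)))
   (Seq (Store (addr_expr 3 (Bin Plus (Reg 0) (Reg 5)) (Bin Plus (Reg 0) (Reg 6)) (Const 0))
          (Load (Bin Plus square_n (Reg 3))))
        (incr 3))))"

definition output_body :: com where
  "output_body =
    Seq (Assign 5 (Bin Div (Reg 3) (Reg 0)))
   (Seq (Assign 6 (Bin Mod (Reg 3) (Reg 0)))
   (Seq (Store (Bin Plus (Bin Plus square_n square_n) (Reg 3))
          (Load (addr_expr 2 (Const 1) (Load (addr_expr 3 (Const 1) (Reg 5) (Const 0)))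
             (Load (addr_expr 3 (Const 1) (Bin Plus (Reg 0) (Reg 6)) (Const 0))))))
        (incr 3)))"

definition mult_prog :: "nat \<Rightarrow> (nat \<Rightarrow> nat \<Rightarrow> nat) \<Rightarrow> (nat \<Rightarrow> nat \<Rightarrow> nat) \<Rightarrow> com" where
  "mult_prog q add_code mult_code =
    Seq (Assign 1 (Bin Plus double_n (Const q)))
   (Seq (store_table q add_code)
   (Seq (Assign 2 (Reg 0))
   (Seq (While (Bin Less (Reg 2) double_n) (Seq (store_table q mult_code) (incr 2)))
   (Seq (While (Bin Less (Reg 3) square_n) copy_body)
   (Seq (Assign 2 (Reg 0))
   (Seq (While (Bin Less (Const 1) (Reg 2)) node_body)
   (Seq (Assign 3 (Const 0))
        (While (Bin Less (Reg 3) square_n) output_body))))))))"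

section \<open>The heap of coordinates, classes of vectors and their inner products\<close>

locale mult_instance =
  fixes A B :: "'a::{field, finite} mat" and n q w :: nat and enc :: "'a \<Rightarrow> nat" and S :: nat
  assumes A: "A \<in> carrier_mat n n" and B: "B \<in> carrier_mat n n"
    and enc: "bij_betw enc UNIV {..<q}"
    and S_eq: "S = 2 * n + q"
    and S_bound: "6 * S ^ 3 \<le> 2 ^ w"
begin

lemma q_ge_2: "2 \<le> q"
proof -
  have "card {0::'a, 1} \<le> CARD('a)" by (rule card_mono) auto
  also have "CARD('a) = q" using bij_betw_same_card[OF enc] by simp
  finally show ?thesis by simp
qed

sublocale word_bound w S
  by unfold_locales (use q_ge_2 S_eq S_bound in auto)

lemma enc_less: "enc x < q" using enc unfolding bij_betw_def by auto

lemma enc_eq_iff: "enc x = enc y \<longleftrightarrow> x = y" using enc unfolding bij_betw_def inj_on_def by auto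

definition dec :: "nat \<Rightarrow> 'a" where "dec = the_inv enc"

lemma dec_enc [simp]: "dec (enc x) = x"
  unfolding dec_def by (rule the_inv_f_f) (use enc in \<open>simp add: bij_betw_def\<close>)

definition add_code :: "nat \<Rightarrow> nat \<Rightarrow> nat" where "add_code a b = enc (dec a + dec b)"
definition mult_code :: "nat \<Rightarrow> nat \<Rightarrow> nat" where "mult_code a b = enc (dec a * dec b)"

definition vec_entry :: "nat \<Rightarrow> nat \<Rightarrow> 'a" where
  "vec_entry i k = (if i < n then A $$ (i, k) else B $$ (k, i - n))"

text \<open>The vectors are the rows of \<open>A\<close> (index \<open>i < n\<close>) and the columns of \<open>B\<close> (index \<open>n + j\<close>);
  they are cut along the heap with root 1 and leaves \<open>n, \<dots>, 2 n - 1\<close>, leaf \<open>n + k\<close> carrying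
  coordinate \<open>k\<close>.  At an inner node the class of a vector is named by its smallest member, at a
  leaf by the code of the entry.\<close>

function rep :: "nat \<Rightarrow> nat \<Rightarrow> nat" where
  "rep p i = (if p = 0 \<or> n \<le> p then enc (vec_entry i (p - n))
     else LEAST j. rep (2 * p) j = rep (2 * p) i \<and> rep (Suc (2 * p)) j = rep (Suc (2 * p)) i)"
  by auto
termination by (relation "measure (\<lambda>(p, i). n - p)") auto

text \<open>Rows and columns form one family of \<open>2 * n\<close> vectors; the matrix product is
  the part with \<open>i < n\<close> and \<open>n \<le> j\<close> at the root. The case
  \<open>p = 0\<close> stops the recursion where doubling would not increase the node.\<close>

function dot :: "nat \<Rightarrow> nat \<Rightarrow> nat \<Rightarrow> 'a" where
  "dot p i j = (if p = 0 \<or> n \<le> p then vec_entry i (p - n) * vec_entry j (p - n)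
     else dot (2 * p) i j + dot (Suc (2 * p)) i j)"
  by auto
termination by (relation "measure (\<lambda>(p, i, j). n - p)") auto

function leaves :: "nat \<Rightarrow> nat set" where
  "leaves p = (if p = 0 \<or> n \<le> p then {p - n} else leaves (2 * p) \<union> leaves (Suc (2 * p)))"
  by auto
termination by (relation "measure (\<lambda>p. n - p)") auto

declare rep.simps [simp del] dot.simps [simp del] leaves.simps [simp del]

lemma rep_leaf: "n \<le> p \<Longrightarrow> rep p i = enc (vec_entry i (p - n))"
  by (simp add: rep.simps)

lemma rep_node: "0 < p \<Longrightarrow> p < n \<Longrightarrow>
    rep p i = (LEAST j. rep (2 * p) j = rep (2 * p) i \<and> rep (Suc (2 * p)) j = rep (Suc (2 * p)) i)"
  by (subst rep.simps) simp

lemma rep_node_le: "0 < p \<Longrightarrow> p < n \<Longrightarrow> rep p i \<le> i"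
  unfolding rep_node by (rule Least_le) simp

lemma rep_less: "0 < p \<Longrightarrow> i < 2 * n \<Longrightarrow> rep p i < S"
  using rep_node_le[of p i] enc_less[of "vec_entry i (p - n)"] rep_leaf[of p i] S_eq
  by (cases "p < n") auto

lemma rep_node_children:
  assumes "0 < p" "p < n"
  shows "rep (2 * p) (rep p i) = rep (2 * p) i \<and> rep (Suc (2 * p)) (rep p i) = rep (Suc (2 * p)) i"
  unfolding rep_node[OF assms] by (rule LeastI[of _ i]) simp

lemma rep_node_eq_iff:
  assumes "0 < p" "p < n"
  shows "rep p i = rep p j \<longleftrightarrow> rep (2 * p) i = rep (2 * p) j \<and> rep (Suc (2 * p)) i = rep (Suc (2 * p)) j"
proof
  assume "rep p i = rep p j"
  then show "rep (2 * p) i = rep (2 * p) j \<and> rep (Suc (2 * p)) i = rep (Suc (2 * p)) j"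
    using rep_node_children[OF assms] by metis
next
  assume "rep (2 * p) i = rep (2 * p) j \<and> rep (Suc (2 * p)) i = rep (Suc (2 * p)) j"
  then show "rep p i = rep p j" unfolding rep_node[OF assms] by simp
qed

lemma rep_rep: "0 < p \<Longrightarrow> p < n \<Longrightarrow> rep p (rep p i) = rep p i"
  using rep_node_eq_iff rep_node_children by simp

text \<open>Connects the classes formed by the program with the restrictions counted by
  neighbourhood complexity: \<open>enc\<close> is injective at a leaf, and agreement on a union is
  agreement on both halves.\<close>

lemma rep_eq_iff: "0 < p \<Longrightarrow> rep p i = rep p j \<longleftrightarrow> (\<forall>k\<in>leaves p. vec_entry i k = vec_entry j k)"
proof (induction p rule: leaves.induct)
  case (1 p)
  show ?case
  proof (cases "n \<le> p")
    case True
    then show ?thesis by (simp add: rep_leaf leaves.simps enc_eq_iff)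
  next
    case False
    then show ?thesis
      using 1 by (subst leaves.simps) (auto simp: rep_node_eq_iff)
  qed
qed

text \<open>Justifies keeping one table entry per pair of classes instead of one per pair of
  vectors.\<close>

lemma dot_cong: "0 < p \<Longrightarrow> rep p i = rep p i' \<Longrightarrow> rep p j = rep p j' \<Longrightarrow> dot p i j = dot p i' j'"
proof (induction p i j rule: dot.induct)
  case (1 p i j)
  show ?case
  proof (cases "n \<le> p")
    case True
    then show ?thesis using 1(4,5) by (simp add: rep_leaf dot.simps enc_eq_iff)
  next
    case False
    then show ?thesis
      using 1 by (subst (1 2) dot.simps) (auto simp: rep_node_eq_iff)
  qed
qed

lemma leaves_subset: "0 < p \<Longrightarrow> p < 2 * n \<Longrightarrow> leaves p \<subseteq> {..<n}"
proof (induction p rule: leaves.induct)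
  case (1 p)
  then show ?case by (subst leaves.simps) auto
qed

lemma leaves_nonempty: "leaves p \<noteq> {}"
proof (induction p rule: leaves.induct)
  case (1 p)
  then show ?case by (subst leaves.simps) auto
qed

text \<open>Each child of \<open>p\<close> has an index of at least \<open>2 * p\<close>, so its
  bound shows that it contributes at most \<open>n\<close> to \<open>p * card (leaves p)\<close>. At
  a leaf the bound is \<open>p < 2 * n\<close>.\<close>

lemma card_leaves_le: "0 < p \<Longrightarrow> p < 2 * n \<Longrightarrow> p * card (leaves p) \<le> 2 * n"
proof (induction p rule: leaves.induct)
  case (1 p)
  show ?case
  proof (cases "n \<le> p")
    case True
    then show ?thesis using 1(4) by (simp add: leaves.simps)
  next
    case False
    have "2 * p * card (leaves (2 * p)) \<le> 2 * n" "(Suc (2 * p)) * card (leaves (Suc (2 * p))) \<le> 2 * n"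
      using 1 False by auto
    moreover have "card (leaves p) \<le> card (leaves (2 * p)) + card (leaves (Suc (2 * p)))"
      using False 1(3) by (subst leaves.simps) (simp add: card_Un_le)
    then have "p * card (leaves p) \<le> p * card (leaves (2 * p)) + p * card (leaves (Suc (2 * p)))"
      by (metis add_mult_distrib2 mult_le_mono2)
    ultimately show ?thesis by (simp add: algebra_simps)
  qed
qed

text \<open>Replacing the smallest node of the level \<open>m, \<dots>, 2 m - 1\<close> by its two children gives the
  next level, also when \<open>n\<close> is not a power of two.\<close>

lemma dot_root:
  assumes "0 < m" "m \<le> n"
  shows "dot 1 i j = (\<Sum>p=m..<2 * m. dot p i j)"
  using assms
proof (induction m)
  case (Suc m)
  show ?case
  proof (cases "m = 0")
    case False
    have "(\<Sum>p=m..<2 * m. dot p i j) = dot m i j + (\<Sum>p=Suc m..<2 * m. dot p i j)"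
      using False by (simp add: sum.atLeast_Suc_lessThan)
    also have "dot m i j = dot (2 * m) i j + dot (Suc (2 * m)) i j"
      using False Suc.prems by (subst dot.simps) simp
    finally show ?thesis using Suc False by (simp add: algebra_simps)
  qed (simp add: numeral_2_eq_2)
qed simp

lemma dot_root_eq_mult:
  assumes "i < n" "j < n"
  shows "dot 1 i (n + j) = (A * B) $$ (i, j)"
proof -
  have "dot 1 i (n + j) = (\<Sum>p=n..<2 * n. vec_entry i (p - n) * vec_entry (n + j) (p - n))"
    using dot_root[of n] assms by (simp add: dot.simps)
  also have "\<dots> = (\<Sum>k=0..<n. vec_entry i k * vec_entry (n + j) k)"
    using sum.shift_bounds_nat_ivl[of "\<lambda>p. vec_entry i (p - n) * vec_entry (n + j) (p - n)" 0 n n]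
    by (simp add: mult_2)
  also have "\<dots> = (A * B) $$ (i, j)"
    using A B assms by (simp add: scalar_prod_def vec_entry_def)
  finally show ?thesis .
qed

section \<open>Invariants of the tables and correctness of one node\<close>

definition class_reps :: "nat \<Rightarrow> nat \<Rightarrow> nat list" where
  "class_reps p i = filter (\<lambda>j. rep p j = j) [0..<i]"

text \<open>The node loop treats \<open>p = n - 1, \<dots>, 1\<close> in this order: representatives are present for the
  nodes from \<open>l\<close> on, inner products from \<open>m\<close> on, and hash tables are still empty below \<open>r\<close>.\<close>

definition tables :: "nat \<Rightarrow> nat \<Rightarrow> nat \<Rightarrow> (nat \<Rightarrow> nat) \<Rightarrow> bool" where
  "tables l m r M \<longleftrightarrow>
    (\<forall>a<q. \<forall>b<q. M (addr S 2 0 a b) = add_code a b) \<and>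
    (\<forall>p i. l \<le> p \<longrightarrow> p < 2 * n \<longrightarrow> i < 2 * n \<longrightarrow> M (addr S 3 p i 0) = rep p i) \<and>
    (\<forall>p i j. m \<le> p \<longrightarrow> p < 2 * n \<longrightarrow> i < 2 * n \<longrightarrow> j < 2 * n \<longrightarrow>
      M (addr S 2 p (rep p i) (rep p j)) = enc (dot p i j)) \<and>
    (\<forall>p x y. p < r \<longrightarrow> x < S \<longrightarrow> y < S \<longrightarrow> M (addr S 5 p x y) = 0)"

lemma S_gt: "2 * n < S" "q \<le> S" "0 < S" using S_eq q_ge_2 by auto

text \<open>First of four frame rules, one per tag: a write is harmless if it hits a hash table from
  \<open>r\<close> on, an inner product strictly between nodes 0 and \<open>m\<close>, a
  representative below \<open>l\<close>, or the list.\<close>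

lemma tables_upd1:
  "tables l m r M \<Longrightarrow> 0 < m \<Longrightarrow> r \<le> p \<Longrightarrow> r \<le> 2 * n \<Longrightarrow> p < S \<Longrightarrow> x < S \<Longrightarrow> y < S \<Longrightarrow>
    tables l m r (M(addr S 5 p x y := v))"
  using S_gt unfolding tables_def by (auto simp: addr_eq_iff rep_less)

lemma tables_upd2:
  "tables l m r M \<Longrightarrow> 0 < p \<Longrightarrow> p < m \<Longrightarrow> r \<le> 2 * n \<Longrightarrow> p < S \<Longrightarrow> x < S \<Longrightarrow> y < S \<Longrightarrow>
    tables l m r (M(addr S 2 p x y := v))"
  using S_gt unfolding tables_def by (auto simp: addr_eq_iff rep_less)

lemma tables_upd3:
  "tables l m r M \<Longrightarrow> 0 < m \<Longrightarrow> p < l \<Longrightarrow> r \<le> 2 * n \<Longrightarrow> p < S \<Longrightarrow> x < S \<Longrightarrow> y < S \<Longrightarrow>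
    tables l m r (M(addr S 3 p x y := v))"
  using S_gt unfolding tables_def by (auto simp: addr_eq_iff rep_less)

lemma tables_upd4:
  "tables l m r M \<Longrightarrow> 0 < m \<Longrightarrow> r \<le> 2 * n \<Longrightarrow> p < S \<Longrightarrow> x < S \<Longrightarrow> y < S \<Longrightarrow>
    tables l m r (M(addr S 4 p x y := v))"
  using S_gt unfolding tables_def by (auto simp: addr_eq_iff rep_less)

text \<open>Expected hash cell after the first \<open>i\<close> vectors. The \<open>LEAST\<close> is
  not restricted to indices below \<open>i\<close>, but lies there as soon as one such index
  qualifies; this makes it agree with \<open>rep\<close>.\<close>

definition hash_val :: "nat \<Rightarrow> nat \<Rightarrow> nat \<Rightarrow> nat \<Rightarrow> nat" where
  "hash_val p i x y = (if \<exists>j<i. rep (2 * p) j = x \<and> rep (Suc (2 * p)) j = y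
     then Suc (LEAST j. rep (2 * p) j = x \<and> rep (Suc (2 * p)) j = y) else 0)"

lemma hash_val_nonzero:
  assumes "0 < p" "p < n" "hash_val p i (rep (2 * p) i) (rep (Suc (2 * p)) i) \<noteq> 0"
  shows "hash_val p i (rep (2 * p) i) (rep (Suc (2 * p)) i) = Suc (rep p i)" "rep p i < i"
proof -
  obtain j where j: "j < i" "rep (2 * p) j = rep (2 * p) i \<and> rep (Suc (2 * p)) j = rep (Suc (2 * p)) i"
    using assms(3) unfolding hash_val_def by (metis (no_types, lifting))
  show "hash_val p i (rep (2 * p) i) (rep (Suc (2 * p)) i) = Suc (rep p i)"
    using j unfolding hash_val_def rep_node[OF assms(1,2)] by auto
  have "rep p i \<le> j" unfolding rep_node[OF assms(1,2)] using j(2) by (rule Least_le)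
  then show "rep p i < i" using j(1) by simp
qed

text \<open>A smaller representative would have the same pair of child classes and would already
  have filled the cell, so a miss means that \<open>i\<close> opens a new class.\<close>

lemma hash_val_zero:
  assumes "0 < p" "p < n" "hash_val p i (rep (2 * p) i) (rep (Suc (2 * p)) i) = 0"
  shows "rep p i = i"
proof (rule ccontr)
  assume "rep p i \<noteq> i"
  then have "rep p i < i" using rep_node_le[OF assms(1,2), of i] by simp
  then show False
    using assms(3) rep_node_children[OF assms(1,2), of i] unfolding hash_val_def
    by (auto split: if_splits)
qed

lemma hash_val_Suc:
  assumes "0 < p" "p < n"
  shows "hash_val p (Suc i) x y =
    (if x = rep (2 * p) i \<and> y = rep (Suc (2 * p)) i then Suc (rep p i) else hash_val p i x y)"
  unfolding hash_val_def rep_node[OF assms] by (auto simp: less_Suc_eq)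

definition row_inv :: "nat \<Rightarrow> nat \<Rightarrow> state \<Rightarrow> bool" where
  "row_inv p i s \<longleftrightarrow> (case s of (R, M) \<Rightarrow>
    R 0 = n \<and> R 1 = S \<and> R 2 = p \<and> R 3 = i \<and> R 4 = length (class_reps p i) \<and>
    tables (Suc p) (Suc p) p M \<and>
    (\<forall>j<i. M (addr S 3 p j 0) = rep p j) \<and>
    (\<forall>x<S. \<forall>y<S. M (addr S 5 p x y) = hash_val p i x y) \<and>
    (\<forall>z<length (class_reps p i). M (addr S 4 z 0 0) = class_reps p i ! z))"

definition pair_inv :: "nat \<Rightarrow> nat \<Rightarrow> state \<Rightarrow> bool" where
  "pair_inv p e s \<longleftrightarrow> (case s of (R, M) \<Rightarrow> let xs = class_reps p (2 * n); c = length xs in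
    R 0 = n \<and> R 1 = S \<and> R 2 = p \<and> R 3 = e \<and> R 4 = c \<and>
    tables p (Suc p) p M \<and>
    (\<forall>z<c. M (addr S 4 z 0 0) = xs ! z) \<and>
    (\<forall>e'<e. M (addr S 2 p (xs ! (e' div c)) (xs ! (e' mod c)))
        = enc (dot p (xs ! (e' div c)) (xs ! (e' mod c)))))"

lemma length_class_reps: "length (class_reps p i) \<le> i"
  unfolding class_reps_def using length_filter_le[of _ "[0..<i]"] by simp

lemma class_reps_nth:
  "z < length (class_reps p i) \<Longrightarrow> class_reps p i ! z < i \<and> rep p (class_reps p i ! z) = class_reps p i ! z"
  using nth_mem[of z "class_reps p i"] unfolding class_reps_def by auto

lemma row_body_correct:
  assumes p: "0 < p" "p < n" and i: "i < 2 * n" and inv: "row_inv p i s"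
  shows "wp w row_body s (\<lambda>t s'. t \<le> 150 \<and> row_inv p (Suc i) s')"
proof -
  obtain R M where s: "s = (R, M)" by (cases s)
  let ?c = "length (class_reps p i)" and ?x = "rep (2 * p) i" and ?y = "rep (Suc (2 * p)) i"
  have R: "R 0 = n" "R 1 = S" "R (Suc 0) = S" "R 2 = p" "R 3 = i" "R 4 = ?c"
    and T: "tables (Suc p) (Suc p) p M"
    and V: "\<And>j. j < i \<Longrightarrow> M (addr S 3 p j 0) = rep p j"
    and H: "\<And>x y. x < S \<Longrightarrow> y < S \<Longrightarrow> M (addr S 5 p x y) = hash_val p i x y"
    and L: "\<And>z. z < ?c \<Longrightarrow> M (addr S 4 z 0 0) = class_reps p i ! z"
    using inv unfolding row_inv_def s by auto
  have xy: "?x < S" "?y < S" using rep_less p i by auto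
  have lt: "p < S" "i < S" "0 < S" "2 * p < S" "Suc (2 * p) < S" "?c < S" "1 < (2::nat) ^ w"
    "2 * p < 2 ^ w" "Suc (2 * p) < 2 ^ w" "Suc i < 2 ^ w" "Suc ?c < 2 ^ w"
    using p i S_gt S_le less_bound length_class_reps[of p i] by linarith+
  have VM: "M (addr S 3 (2 * p) i 0) = ?x" "M (addr S 3 (Suc (2 * p)) i 0) = ?y"
    using T p i unfolding tables_def by auto
  have rep_lt: "rep p i \<le> i" using p rep_node_le by simp
  note [simp] = R lt xy VM w_pos no_overflow mult_2[symmetric] expr_cost_addr_expr
  note [simp del] = binop_val.simps
  let ?h = "addr S 5 p ?x ?y"
  \<comment> \<open>Both branches end in this memory: on a hit the cell \<open>?h\<close> already
    holds \<open>Suc (rep p i)\<close> and rewriting it changes nothing, on a miss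
    \<open>rep p i = i\<close> and the list grows as recorded in \<open>N\<close>.\<close>
  have final: "row_inv p (Suc i) (R', M')"
    if "R' 0 = n" "R' 1 = S" "R' 2 = p" "R' 3 = Suc i"
      "R' 4 = length (class_reps p (Suc i))"
      "M' = N(?h := Suc (rep p i), addr S 3 p i 0 := rep p i)"
      "N = (if rep p i = i then M(addr S 4 ?c 0 0 := i) else M)"
    for R' M' N
  proof -
    have reps: "class_reps p (Suc i) = class_reps p i @ (if rep p i = i then [i] else [])"
      unfolding class_reps_def by simp
    have "tables (Suc p) (Suc p) p N" using that T p by (simp add: tables_upd4)
    then have "tables (Suc p) (Suc p) p M'"
      unfolding that(6) using p S_gt lt xy by (intro tables_upd3 tables_upd1) auto
    moreover have "\<forall>j<Suc i. M' (addr S 3 p j 0) = rep p j"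
      using V i lt xy S_gt unfolding that(6,7) by (auto simp: addr_eq_iff less_Suc_eq)
    moreover have "\<forall>x<S. \<forall>y<S. M' (addr S 5 p x y) = hash_val p (Suc i) x y"
      using H lt xy S_gt unfolding that(6,7) by (auto simp: addr_eq_iff hash_val_Suc[OF p])
    moreover have "\<forall>z<length (class_reps p (Suc i)). M' (addr S 4 z 0 0) = class_reps p (Suc i) ! z"
    proof (intro allI impI)
      fix z assume z: "z < length (class_reps p (Suc i))"
      then have "z < S" using length_class_reps[of p "Suc i"] i S_gt by linarith
      then show "M' (addr S 4 z 0 0) = class_reps p (Suc i) ! z"
        using L z lt xy S_gt unfolding that(6,7)
        by (auto simp: addr_eq_iff reps nth_append less_Suc_eq split: if_splits)
    qed
    ultimately show ?thesis using that unfolding row_inv_def by simp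
  qed
  have len: "length (class_reps p (Suc i)) = (if rep p i = i then Suc ?c else ?c)"
    unfolding class_reps_def by simp
  show ?thesis
    unfolding s row_body_def
    apply (rule wp_Seq, rule wp_Assign_val[where v = ?x])
    subgoal by simp
    apply (rule wp_Seq, rule wp_Assign_val[where v = ?y])
    subgoal by simp
    apply (rule wp_Seq, rule wp_Assign_val[where v = ?h])
    subgoal by simp
    apply (rule wp_Seq, rule wp_If)
    subgoal premises prem
    proof -
      have hv: "hash_val p i ?x ?y \<noteq> 0" using prem H by simp
      note h = hash_val_nonzero[OF p hv]
      have Mh: "M ?h = Suc (rep p i)" using H h(1) by simp
      have suc_lt: "Suc (rep p i) < 2 ^ w" using h(2) lt by linarith
      have M_eq: "M = M(?h := Suc (rep p i))" using Mh by auto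
      show ?thesis
        apply (rule wp_Skip)
        apply (rule wp_Seq, rule wp_Store_val[where x = "addr S 3 p i 0" and v = "rep p i"])
        subgoal by simp
        subgoal using Mh suc_lt by simp
        apply (rule wp_Assign_val[where v = "Suc i"])
        subgoal by simp
        subgoal using h(2) M_eq by (intro conjI final[where N = M]) (simp_all add: len)
        done
    qed
    subgoal premises prem
    proof -
      have hv: "hash_val p i ?x ?y = 0" using prem H by simp
      note h = hash_val_zero[OF p hv]
      show ?thesis
        apply (rule wp_Seq, rule wp_Store_val[where x = ?h and v = "Suc i"])
        subgoal by simp
        subgoal by simp
        apply (rule wp_Seq, rule wp_Store_val[where x = "addr S 4 ?c 0 0" and v = "i"])
        subgoal by simp
        subgoal by simp
        apply (rule wp_Assign_val[where v = "Suc ?c"])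
        subgoal by simp
        apply (rule wp_Seq, rule wp_Store_val[where x = "addr S 3 p i 0" and v = "i"])
        subgoal by simp
        subgoal using h by (simp add: addr_eq_iff)
        apply (rule wp_Assign_val[where v = "Suc i"])
        subgoal by simp
        subgoal using h
          by (intro conjI final[where N = "M(addr S 4 ?c 0 0 := i)"])
            (simp_all add: len fun_upd_twist addr_eq_iff)
        done
    qed
    done
qed

lemma pair_body_correct:
  assumes p: "0 < p" "p < n" and inv: "pair_inv p e s"
    and e: "e < length (class_reps p (2 * n)) * length (class_reps p (2 * n))"
  shows "wp w pair_body s (\<lambda>t s'. t \<le> 250 \<and> pair_inv p (Suc e) s')"
proof -
  obtain R M where s: "s = (R, M)" by (cases s)
  define xs where "xs = class_reps p (2 * n)"
  define c where "c = length xs"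
  define i j where "i = xs ! (e div c)" and "j = xs ! (e mod c)"
  have R: "R 0 = n" "R 1 = S" "R (Suc 0) = S" "R 2 = p" "R 3 = e" "R 4 = c"
    and T: "tables p (Suc p) p M"
    and L: "\<And>z. z < c \<Longrightarrow> M (addr S 4 z 0 0) = xs ! z"
    and P: "\<And>e'. e' < e \<Longrightarrow> M (addr S 2 p (xs ! (e' div c)) (xs ! (e' mod c)))
        = enc (dot p (xs ! (e' div c)) (xs ! (e' mod c)))"
    using inv unfolding pair_inv_def s xs_def c_def by (auto simp: Let_def)
  have ecc: "e < c * c" using e unfolding xs_def c_def .
  have dm: "e div c < c" "e mod c < c"
    using ecc less_mult_imp_div_less[of e c c] by (auto intro: mod_less_divisor gr0I)
  have ij: "i < 2 * n" "j < 2 * n"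
    using dm class_reps_nth[of _ p "2 * n"] unfolding i_def j_def xs_def c_def by auto
  have c_le: "c \<le> 2 * n" unfolding c_def xs_def by (rule length_class_reps)
  have "c * c \<le> S * S" using c_le S_gt by (intro mult_mono) auto
  then have lt_e: "Suc e < 2 ^ w" "e < 2 ^ w" using ecc S_squared_le S_gt by linarith+
  have lt: "p < S" "i < S" "j < S" "0 < S" "2 * p < S" "Suc (2 * p) < S" "c < S" "e div c < S"
    "e mod c < S" "1 < (2::nat) ^ w" "2 * p < 2 ^ w" "Suc (2 * p) < 2 ^ w"
    using p S_gt S_le less_bound c_le dm ij by linarith+
  have reps_lt: "rep (2 * p) i < S" "rep (2 * p) j < S" "rep (Suc (2 * p)) i < S" "rep (Suc (2 * p)) j < S"
    using p ij by (auto intro: rep_less)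
  have LM: "M (addr S 4 (e div c) 0 0) = i" "M (addr S 4 (e mod c) 0 0) = j"
    using L dm unfolding i_def j_def by auto
  have VM: "M (addr S 3 (2 * p) i 0) = rep (2 * p) i" "M (addr S 3 (Suc (2 * p)) i 0) = rep (Suc (2 * p)) i"
    "M (addr S 3 (2 * p) j 0) = rep (2 * p) j" "M (addr S 3 (Suc (2 * p)) j 0) = rep (Suc (2 * p)) j"
    using T p ij unfolding tables_def by auto
  define u v where "u = enc (dot (2 * p) i j)" and "v = enc (dot (Suc (2 * p)) i j)"
  have TM: "M (addr S 2 (2 * p) (rep (2 * p) i) (rep (2 * p) j)) = u"
    "M (addr S 2 (Suc (2 * p)) (rep (Suc (2 * p)) i) (rep (Suc (2 * p)) j)) = v"
    using T p ij unfolding tables_def u_def v_def by auto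
  have uvq: "u < q" "v < q" unfolding u_def v_def by (simp_all add: enc_less)
  then have uv: "u < S" "v < S" using S_gt by auto
  have "M (addr S 2 0 u v) = add_code u v" using T uvq unfolding tables_def by auto
  also have "\<dots> = enc (dot p i j)"
    using p unfolding add_code_def u_def v_def by (subst (3) dot.simps) simp
  finally have AM: "M (addr S 2 0 u v) = enc (dot p i j)" .
  have final: "pair_inv p (Suc e) (R', M(addr S 2 p i j := enc (dot p i j)))"
    if "R' 0 = n" "R' 1 = S" "R' 2 = p" "R' 3 = Suc e" "R' 4 = c" for R'
  proof -
    let ?M = "M(addr S 2 p i j := enc (dot p i j))"
    have "tables p (Suc p) p ?M" using T p lt by (intro tables_upd2) auto
    moreover have "\<forall>z<c. ?M (addr S 4 z 0 0) = xs ! z"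
      using L lt c_le S_gt by (auto simp: addr_eq_iff)
    moreover have "?M (addr S 2 p (xs ! (e' div c)) (xs ! (e' mod c)))
        = enc (dot p (xs ! (e' div c)) (xs ! (e' mod c)))" if e': "e' < Suc e" for e'
    proof (cases "e' = e")
      case True
      then show ?thesis unfolding i_def j_def by simp
    next
      case False
      then have "e' < e" using e' by simp
      then have "e' < c * c" using ecc by simp
      then have "e' div c < c" "e' mod c < c"
        using less_mult_imp_div_less[of e' c c] by (auto intro: mod_less_divisor gr0I)
      then have "xs ! (e' div c) < S" "xs ! (e' mod c) < S"
        using class_reps_nth[of _ p "2 * n"] S_gt unfolding xs_def c_def by fastforce+
      then show ?thesis using P[OF \<open>e' < e\<close>] lt by (auto simp: addr_eq_iff)
    qed
    ultimately show ?thesis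
      using that unfolding pair_inv_def xs_def c_def by (simp add: Let_def)
  qed
  note [simp] = R lt lt_e uv VM LM TM AM reps_lt w_pos no_overflow mult_2[symmetric] expr_cost_addr_expr
  note [simp del] = binop_val.simps
  show ?thesis
    unfolding s pair_body_def
    apply (rule wp_Seq, rule wp_Assign_val[where v = i])
    subgoal by simp
    apply (rule wp_Seq, rule wp_Assign_val[where v = j])
    subgoal by simp
    apply (rule wp_Seq, rule wp_Assign_val[where v = u])
    subgoal by simp
    apply (rule wp_Seq, rule wp_Assign_val[where v = v])
    subgoal by simp
    apply (rule wp_Seq, rule wp_Store_val[where x = "addr S 2 p i j" and v = "enc (dot p i j)"])
    subgoal by simp
    subgoal by simp
    apply (rule wp_Assign_val[where v = "Suc e"])
    subgoal by simp
    subgoal by (intro conjI final) simp_all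
    done
qed

definition node_inv :: "nat \<Rightarrow> state \<Rightarrow> bool" where
  "node_inv p s \<longleftrightarrow> fst s 0 = n \<and> fst s 1 = S \<and> fst s 2 = p \<and> tables p p p (snd s)"

text \<open>\<open>312 = 2 * (150 + 6)\<close> and \<open>256 = 250 + 6\<close>, where 6 pays for
  one evaluation of the loop guard.\<close>

lemma node_body_correct:
  assumes p: "0 < p" "p < n" and inv: "node_inv (Suc p) s"
  defines "c \<equiv> length (class_reps p (2 * n))"
  shows "wp w node_body s (\<lambda>t s'. t \<le> 50 + 312 * n + 256 * (c * c) \<and> node_inv p s')"
proof -
  obtain R M where s: "s = (R, M)" by (cases s)
  have R: "R 0 = n" "R 1 = S" "R (Suc 0) = S" "R 2 = Suc p"
    and T: "tables (Suc p) (Suc p) (Suc p) M"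
    using inv unfolding node_inv_def s by auto
  have c_le: "c \<le> 2 * n" unfolding c_def by (rule length_class_reps)
  have "c * c \<le> S * S" using c_le S_gt by (intro mult_mono) auto
  then have lt: "c * c < 2 ^ w" "Suc p < 2 ^ w" "2 * n < 2 ^ w" "p < S"
    using p S_squared_le S_gt S_le by linarith+
  \<comment> \<open>The hash table of \<open>p\<close> is empty by the bound \<open>Suc p\<close> in
    \<open>T\<close>; from here on emptiness is kept only below \<open>p\<close>, since this table
    gets filled.\<close>
  have row_init: "row_inv p 0 (R', M)" if "R' 0 = n" "R' 1 = S" "R' 2 = p" "R' 3 = 0" "R' 4 = 0" for R'
    using that T lt(4) unfolding row_inv_def tables_def
    by (auto simp: class_reps_def hash_val_def)
  have pair_init: "pair_inv p 0 ((fst s')(3 := 0), snd s')" if "row_inv p (2 * n) s'" for s'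
  proof -
    obtain R' M' where s': "s' = (R', M')" by (cases s')
    have R': "R' 0 = n" "R' 1 = S" "R' 2 = p" "R' 4 = c" and T': "tables (Suc p) (Suc p) p M'"
      and V': "\<And>j. j < 2 * n \<Longrightarrow> M' (addr S 3 p j 0) = rep p j"
      and L': "\<forall>z<c. M' (addr S 4 z 0 0) = class_reps p (2 * n) ! z"
      using that unfolding row_inv_def s' c_def by auto
    have "M' (addr S 3 m i 0) = rep m i" if "p \<le> m" "m < 2 * n" "i < 2 * n" for m i
      using that T' V' unfolding tables_def by (cases "m = p") auto
    then have "tables p (Suc p) p M'" using T' unfolding tables_def by blast
    then show ?thesis using R' L' unfolding pair_inv_def s' c_def by (simp add: Let_def)
  qed
  have pair_final: "node_inv p s'" if "pair_inv p (c * c) s'" for s'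
  proof -
    obtain R' M' where s': "s' = (R', M')" by (cases s')
    let ?xs = "class_reps p (2 * n)"
    have R': "R' 0 = n" "R' 1 = S" "R' 2 = p" and T': "tables p (Suc p) p M'"
      and P: "\<And>e. e < c * c \<Longrightarrow> M' (addr S 2 p (?xs ! (e div c)) (?xs ! (e mod c)))
        = enc (dot p (?xs ! (e div c)) (?xs ! (e mod c)))"
      using that unfolding pair_inv_def s' c_def by (auto simp: Let_def)
    \<comment> \<open>The loop has filled only the cells of listed representatives. By
      \<open>rep_rep\<close> the list contains the representative of every vector, and
      \<open>dot_cong\<close> passes from representatives to \<open>i\<close> and
      \<open>j\<close>.\<close>
    have "M' (addr S 2 p (rep p i) (rep p j)) = enc (dot p i j)" if ij: "i < 2 * n" "j < 2 * n" for i j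
    proof -
      have "rep p i \<in> set ?xs" "rep p j \<in> set ?xs"
        using ij rep_node_le[OF p, of i] rep_node_le[OF p, of j] rep_rep[OF p]
        by (auto simp: class_reps_def)
      then obtain y z where yz: "y < c" "z < c" "?xs ! y = rep p i" "?xs ! z = rep p j"
        unfolding c_def by (metis in_set_conv_nth)
      then have "(y * c + z) div c = y" "(y * c + z) mod c = z" by auto
      moreover have "y * c + z < c * c"
        using yz(1,2) mult_right_mono[of "Suc y" c c] by simp
      ultimately have "M' (addr S 2 p (rep p i) (rep p j)) = enc (dot p (rep p i) (rep p j))"
        using P[of "y * c + z"] yz by simp
      also have "dot p (rep p i) (rep p j) = dot p i j"
        using p by (intro dot_cong) (simp_all add: rep_rep)
      finally show ?thesis .
    qed
    then have "M' (addr S 2 m (rep m i) (rep m j)) = enc (dot m i j)"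
      if "p \<le> m" "m < 2 * n" "i < 2 * n" "j < 2 * n" for m i j
      using that T' unfolding tables_def by (cases "m = p") auto
    then have "tables p p p M'" using T' unfolding tables_def by blast
    then show ?thesis using R' s' unfolding node_inv_def by simp
  qed
  have rows: "wp w (While (Bin Less (Reg 3) double_n) row_body) s'
      (\<lambda>t s'. t \<le> (\<Sum>i<2 * n. 150 + Suc (expr_cost (Bin Less (Reg 3) double_n)))
        + Suc (expr_cost (Bin Less (Reg 3) double_n)) \<and> row_inv p (2 * n) s')"
    if "row_inv p 0 s'" for s'
  proof (rule wp_While)
    fix i s' assume i: "i < 2 * n" and inv': "row_inv p i s'"
    have "expr_val w s' (Bin Less (Reg 3) double_n) \<noteq> 0"
      using inv' i lt unfolding row_inv_def
      by (auto simp: no_overflow mult_2[symmetric] simp del: binop_val.simps)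
    then show "expr_val w s' (Bin Less (Reg 3) double_n) \<noteq> 0 \<and>
        wp w row_body s' (\<lambda>t s'. t \<le> 150 \<and> row_inv p (Suc i) s')"
      using row_body_correct[OF p i inv'] by simp
  next
    fix s' assume "row_inv p (2 * n) s'"
    then show "expr_val w s' (Bin Less (Reg 3) double_n) = 0"
      using lt unfolding row_inv_def
      by (auto simp: no_overflow mult_2[symmetric] simp del: binop_val.simps)
  qed (rule that)
  have pairs: "wp w (While (Bin Less (Reg 3) (Bin Times (Reg 4) (Reg 4))) pair_body) s'
      (\<lambda>t s'. t \<le> (\<Sum>e<c * c. 250 + Suc (expr_cost (Bin Less (Reg 3) (Bin Times (Reg 4) (Reg 4)))))
        + Suc (expr_cost (Bin Less (Reg 3) (Bin Times (Reg 4) (Reg 4)))) \<and> pair_inv p (c * c) s')"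
    if "pair_inv p 0 s'" for s'
  proof (rule wp_While)
    fix e s' assume e: "e < c * c" and inv': "pair_inv p e s'"
    have "expr_val w s' (Bin Less (Reg 3) (Bin Times (Reg 4) (Reg 4))) \<noteq> 0"
      using inv' e lt unfolding pair_inv_def c_def
      by (auto simp: no_overflow Let_def simp del: binop_val.simps)
    then show "expr_val w s' (Bin Less (Reg 3) (Bin Times (Reg 4) (Reg 4))) \<noteq> 0 \<and>
        wp w pair_body s' (\<lambda>t s'. t \<le> 250 \<and> pair_inv p (Suc e) s')"
      using pair_body_correct[OF p inv'] e unfolding c_def by simp
  next
    fix s' assume "pair_inv p (c * c) s'"
    then show "expr_val w s' (Bin Less (Reg 3) (Bin Times (Reg 4) (Reg 4))) = 0"
      using lt unfolding pair_inv_def c_def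
      by (auto simp: no_overflow Let_def simp del: binop_val.simps)
  qed (rule that)
  show ?thesis
    unfolding s node_body_def
    apply (rule wp_Seq, rule wp_Assign_val[where v = p])
    subgoal using lt w_pos R by (simp add: no_overflow del: binop_val.simps)
    apply (rule wp_Seq, rule wp_Assign_val[where v = 0])
    subgoal by simp
    apply (rule wp_Seq, rule wp_Assign_val[where v = 0])
    subgoal by simp
    apply (rule wp_Seq, rule wp_mono[OF rows])
    subgoal by (rule row_init) (simp_all add: R R(2)[simplified])
    subgoal premises rows_post for t1 s1
      apply (rule wp_Seq, rule wp_Assign)
      apply (rule wp_mono[OF pairs])
      subgoal using pair_init[of s1] rows_post by simp
      subgoal for t2 s2 using pair_final[of s2] rows_post by simp
      done
    done
qed

section \<open>Initialisation of the leaves from the input\<close>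

definition initialised :: "nat \<Rightarrow> nat \<Rightarrow> state \<Rightarrow> bool" where
  "initialised m e s \<longleftrightarrow> (case s of (R, M) \<Rightarrow>
    R 0 = n \<and> R 1 = S \<and> R 2 = m \<and> R 3 = e \<and>
    (\<forall>x<2 * (n * n). M x = snd (input_state enc n A B) x) \<and>
    (\<forall>a<q. \<forall>b<q. M (addr S 2 0 a b) = add_code a b) \<and>
    (\<forall>p a b. n \<le> p \<longrightarrow> p < m \<longrightarrow> a < q \<longrightarrow> b < q \<longrightarrow> M (addr S 2 p a b) = mult_code a b) \<and>
    (\<forall>p<S. \<forall>x<S. \<forall>y<S. M (addr S 5 p x y) = 0) \<and>
    (\<forall>e'<e. M (addr S 3 (n + e' mod n) (e' div n) 0) = enc (vec_entry (e' div n) (e' mod n)) \<and>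
      M (addr S 3 (n + e' div n) (n + e' mod n) 0) = enc (vec_entry (n + e' mod n) (e' div n))))"

text \<open>Input and output take \<open>3 * (n * n)\<close> cells, fewer than \<open>S * S\<close>
  and hence than \<open>S ^ 3\<close>, where tag 1 would begin.\<close>

lemma addr_ge_input: "0 < t \<Longrightarrow> x < 3 * (n * n) \<Longrightarrow> x < addr S t a b c"
proof -
  assume t: "0 < t" and x: "x < 3 * (n * n)"
  have "2 * n * (2 * n) \<le> S * S" using S_gt by (intro mult_mono) auto
  then have "x < S * S" using x by simp
  also have "\<dots> * 1 \<le> S * S * S" using S_gt by (intro mult_left_mono) auto
  then have "S * S \<le> S ^ 3" by (simp add: power3_eq_cube)
  also have "\<dots> \<le> t * S ^ 3" using t by simp
  also have "\<dots> \<le> addr S t a b c" by (rule addr_ge)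
  finally show ?thesis .
qed

lemma square_bounds: "n * n < 2 ^ w" "3 * (n * n) < 2 ^ w" "2 * n < 2 ^ w" "Suc (2 * n) < 2 ^ w"
proof -
  have "2 * n * (2 * n) \<le> S * S" using S_gt by (intro mult_mono) auto
  moreover have "0 < S * S" using S_gt by simp
  ultimately show "n * n < 2 ^ w" "3 * (n * n) < 2 ^ w" using S_squared_le by linarith+
  show "2 * n < 2 ^ w" "Suc (2 * n) < 2 ^ w" using S_gt S_le by linarith+
qed

lemma code_less: "add_code a b < S" "mult_code a b < S"
  unfolding add_code_def mult_code_def using enc_less S_gt less_le_trans by blast+

lemma copy_body_correct:
  assumes e: "e < n * n" and inv: "initialised (2 * n) e s"
  shows "wp w copy_body s (\<lambda>t s'. t \<le> 80 \<and> initialised (2 * n) (Suc e) s')"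
proof -
  obtain R M where s: "s = (R, M)" by (cases s)
  define i k where "i = e div n" and "k = e mod n"
  have n0: "0 < n" using e by (cases n) auto
  have ik: "i < n" "k < n" unfolding i_def k_def using e n0 less_mult_imp_div_less by auto
  have R: "R 0 = n" "R 1 = S" "R (Suc 0) = S" "R 2 = 2 * n" "R 3 = e"
    and M: "\<And>x. x < 2 * (n * n) \<Longrightarrow> M x = snd (input_state enc n A B) x"
    and rest: "(\<forall>a<q. \<forall>b<q. M (addr S 2 0 a b) = add_code a b) \<and>
    (\<forall>p a b. n \<le> p \<longrightarrow> p < 2 * n \<longrightarrow> a < q \<longrightarrow> b < q \<longrightarrow> M (addr S 2 p a b) = mult_code a b) \<and>
    (\<forall>p<S. \<forall>x<S. \<forall>y<S. M (addr S 5 p x y) = 0)"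
    and V: "\<And>e'. e' < e \<Longrightarrow> M (addr S 3 (n + e' mod n) (e' div n) 0) = enc (vec_entry (e' div n) (e' mod n)) \<and>
      M (addr S 3 (n + e' div n) (n + e' mod n) 0) = enc (vec_entry (n + e' mod n) (e' div n))"
    using inv unfolding initialised_def s by auto
  let ?a = "addr S 3 (n + k) i 0" and ?b = "addr S 3 (n + i) (n + k) 0"
  let ?u = "enc (vec_entry i k)" and ?v = "enc (vec_entry (n + k) i)"
  let ?M = "M(?a := ?u, ?b := ?v)"
  have Me: "M e = ?u" "M (n * n + e) = ?v"
    using M[of e] M[of "n * n + e"] e ik unfolding input_state_def vec_entry_def i_def k_def by auto
  have neq: "n * n + e \<noteq> ?a" using addr_ge_input[of 3 "n * n + e" "n + k" i 0] e by simp
  have lt: "n + k < S" "n + i < S" "i < S" "0 < S" using ik S_gt by auto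
  have lt_w: "e < 2 ^ w" "Suc e < 2 ^ w" "n + k < 2 ^ w" "n + i < 2 ^ w" "n * n + e < 2 ^ w" "n * n < 2 ^ w"
    using e ik square_bounds by linarith+
  have pos: "(0::nat) < 3" by simp
  have final: "initialised (2 * n) (Suc e) (R', ?M)"
    if "R' 0 = n" "R' 1 = S" "R' 2 = 2 * n" "R' 3 = Suc e" for R'
  proof -
    have "?M x = snd (input_state enc n A B) x" if "x < 2 * (n * n)" for x
    proof -
      have "x < 3 * (n * n)" using that by simp
      then have "x \<noteq> ?a" "x \<noteq> ?b" using addr_ge_input[OF pos] by (metis less_irrefl)+
      then show ?thesis using M[OF that] by simp
    qed
    moreover have "(\<forall>a<q. \<forall>b<q. ?M (addr S 2 0 a b) = add_code a b) \<and>
      (\<forall>p a b. n \<le> p \<longrightarrow> p < 2 * n \<longrightarrow> a < q \<longrightarrow> b < q \<longrightarrow> ?M (addr S 2 p a b) = mult_code a b) \<and>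
      (\<forall>p<S. \<forall>x<S. \<forall>y<S. ?M (addr S 5 p x y) = 0)"
      using rest lt S_gt by (auto simp: addr_eq_iff)
    moreover have "?M (addr S 3 (n + e' mod n) (e' div n) 0) = enc (vec_entry (e' div n) (e' mod n)) \<and>
      ?M (addr S 3 (n + e' div n) (n + e' mod n) 0) = enc (vec_entry (n + e' mod n) (e' div n))"
      if "e' < Suc e" for e'
    proof -
      have "e' < n * n" using that e by simp
      then have lt': "e' div n < n" "e' mod n < n" using n0 less_mult_imp_div_less by auto
      then have "e' div n < S" "n + e' mod n < S" "n + e' div n < S" using S_gt by linarith+
      then show ?thesis
        using V[of e'] that lt lt' ik by (auto simp: addr_eq_iff less_Suc_eq i_def k_def)
    qed
    ultimately show ?thesis using that unfolding initialised_def by simp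
  qed
  note [simp] = R lt lt_w w_pos Me no_overflow expr_cost_addr_expr
  note [simp del] = binop_val.simps
  show ?thesis
    unfolding s copy_body_def
    apply (rule wp_Seq, rule wp_Assign_val[where v = i])
    subgoal by (simp add: i_def)
    apply (rule wp_Seq, rule wp_Assign_val[where v = k])
    subgoal by (simp add: k_def)
    apply (rule wp_Seq, rule wp_Store_val[where x = ?a and v = ?u])
    subgoal by simp
    subgoal by simp
    apply (rule wp_Seq, rule wp_Store_val[where x = ?b and v = ?v])
    subgoal by simp
    subgoal using neq by simp
    apply (rule wp_Assign_val[where v = "Suc e"])
    subgoal by simp
    subgoal by (intro conjI final) simp_all
    done
qed

lemma init_body_correct:
  assumes m: "n \<le> m" "m < 2 * n" and inv: "initialised m 0 s"
  shows "wp w (Seq (store_table q mult_code) (incr 2)) s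
    (\<lambda>t s'. t \<le> 15 * (q * q) + 5 \<and> initialised (Suc m) 0 s')"
proof -
  obtain R M where s: "s = (R, M)" by (cases s)
  have R: "R 0 = n" "R 1 = S" "R 2 = m" "R 3 = 0"
    and M: "\<And>x. x < 2 * (n * n) \<Longrightarrow> M x = snd (input_state enc n A B) x"
    and add: "\<And>a b. a < q \<Longrightarrow> b < q \<Longrightarrow> M (addr S 2 0 a b) = add_code a b"
    and mul: "\<And>p a b. n \<le> p \<Longrightarrow> p < m \<Longrightarrow> a < q \<Longrightarrow> b < q \<Longrightarrow> M (addr S 2 p a b) = mult_code a b"
    and H: "\<And>p x y. p < S \<Longrightarrow> x < S \<Longrightarrow> y < S \<Longrightarrow> M (addr S 5 p x y) = 0"
    using inv unfolding initialised_def s by auto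
  have lt: "m < S" "Suc m < 2 ^ w" using m S_gt square_bounds by linarith+
  have final: "initialised (Suc m) 0 (R(2 := Suc m), M')"
    if tab: "\<forall>a<q. \<forall>b<q. M' (addr S 2 m a b) = mult_code a b"
      and frame: "\<forall>x. (\<forall>a<S. \<forall>b<S. x \<noteq> addr S 2 m a b) \<longrightarrow> M' x = M x" for M'
  proof -
    have "M' x = M x" if "x < 2 * (n * n)" for x
    proof -
      have "x < 3 * (n * n)" using that by simp
      then have "x \<noteq> addr S 2 m a b" for a b
        using addr_ge_input[of 2 x m a b] by auto
      then show ?thesis using frame by blast
    qed
    moreover have other: "M' (addr S 2 p a b) = M (addr S 2 p a b)" if "p < m" "a < q" "b < q" for p a b
    proof -
      have "a < S" "b < S" "p < S" using that S_gt lt by auto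
      then show ?thesis using frame that lt by (auto simp: addr_eq_iff)
    qed
    moreover have "M' (addr S 5 p x y) = M (addr S 5 p x y)" if "p < S" "x < S" "y < S" for p x y
      using frame that lt by (auto simp: addr_eq_iff)
    moreover have "M' (addr S 2 0 a b) = add_code a b" if "a < q" "b < q" for a b
      using other[of 0] add that m by simp
    moreover have "M' (addr S 2 p a b) = mult_code a b"
      if "n \<le> p" "p < Suc m" "a < q" "b < q" for p a b
      using that tab other mul by (cases "p = m") auto
    ultimately show ?thesis using R M H unfolding initialised_def by simp
  qed
  show ?thesis
    unfolding s
    apply (rule wp_Seq, rule wp_mono[OF wp_store_table])
    subgoal by (rule R(2))
    subgoal using lt R(3) by simp
    subgoal by (rule S_gt)
    subgoal by (rule code_less)
    subgoal for t s'
      apply (cases s')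
      apply (simp only: fst_conv snd_conv)
      apply (rule wp_Assign_val[where v = "Suc m"])
      subgoal using R lt w_pos by (simp add: no_overflow del: binop_val.simps)
      subgoal using final R(3) by simp
      done
    done
qed

text \<open>At a leaf the class of a vector is the code of its entry, so a multiplication table
  indexed by codes is already the table of inner products.\<close>

lemma initialised_imp_node_inv:
  assumes "initialised (2 * n) (n * n) s" "R' 0 = n" "R' 1 = S" "R' 2 = n"
  shows "node_inv n (R', snd s)"
proof -
  obtain R M where s: "s = (R, M)" by (cases s)
  have V0: "M (addr S 3 (n + e mod n) (e div n) 0) = enc (vec_entry (e div n) (e mod n))"
    "M (addr S 3 (n + e div n) (n + e mod n) 0) = enc (vec_entry (n + e mod n) (e div n))"
    if "e < n * n" for e
    using assms(1) that unfolding initialised_def s by auto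
  have V: "M (addr S 3 p i 0) = rep p i" if p: "n \<le> p" "p < 2 * n" and i: "i < 2 * n" for p i
  proof (cases "i < n")
    case True
    define k where "k = p - n"
    have k: "k < n" "p = n + k" using p unfolding k_def by auto
    have "i * n + k < n * n" using True k mult_right_mono[of "Suc i" n n] by simp
    moreover have "(i * n + k) div n = i" "(i * n + k) mod n = k" using k(1) by auto
    ultimately have "M (addr S 3 (n + k) i 0) = enc (vec_entry i k)"
      using V0(1)[of "i * n + k"] by simp
    then show ?thesis using k by (simp add: rep_leaf)
  next
    case False
    define k j where "k = p - n" and "j = i - n"
    have kj: "k < n" "j < n" "p = n + k" "i = n + j" using False p i unfolding k_def j_def by auto
    have "k * n + j < n * n" using kj mult_right_mono[of "Suc k" n n] by simp
    moreover have "(k * n + j) div n = k" "(k * n + j) mod n = j" using kj(2) by auto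
    ultimately have "M (addr S 3 (n + k) (n + j) 0) = enc (vec_entry (n + j) k)"
      using V0(2)[of "k * n + j"] by simp
    then show ?thesis using kj by (simp add: rep_leaf)
  qed
  have mul: "\<And>p a b. n \<le> p \<Longrightarrow> p < 2 * n \<Longrightarrow> a < q \<Longrightarrow> b < q \<Longrightarrow> M (addr S 2 p a b) = mult_code a b"
    and H: "\<And>p x y. p < S \<Longrightarrow> x < S \<Longrightarrow> y < S \<Longrightarrow> M (addr S 5 p x y) = 0"
    and add: "\<forall>a<q. \<forall>b<q. M (addr S 2 0 a b) = add_code a b"
    using assms(1) unfolding initialised_def s by auto
  have "M (addr S 2 p (rep p i) (rep p j)) = enc (dot p i j)"
    if "n \<le> p" "p < 2 * n" for p i j
    using mul[OF that, of "rep p i" "rep p j"] that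
    by (simp add: rep_leaf enc_less mult_code_def dot.simps)
  moreover have "M (addr S 5 p x y) = 0" if "p < n" "x < S" "y < S" for p x y
    using H that S_gt by simp
  ultimately have "tables n n n M" using V add unfolding tables_def by blast
  then show ?thesis using assms s unfolding node_inv_def by simp
qed

text \<open>The guard \<open>0 < n\<close> is there because for \<open>n = 0\<close> the node loop
  ends at node 0 and not at the root.\<close>

definition output_inv :: "nat \<Rightarrow> state \<Rightarrow> bool" where
  "output_inv e s \<longleftrightarrow> (case s of (R, M) \<Rightarrow>
    R 0 = n \<and> R 1 = S \<and> R 3 = e \<and> (0 < n \<longrightarrow> tables 1 1 1 M) \<and>
    (\<forall>e'<e. M (2 * (n * n) + e') = enc ((A * B) $$ (e' div n, e' mod n))))"

lemma output_body_correct: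
  assumes e: "e < n * n" and inv: "output_inv e s"
  shows "wp w output_body s (\<lambda>t s'. t \<le> 80 \<and> output_inv (Suc e) s')"
proof -
  obtain R M where s: "s = (R, M)" by (cases s)
  define i j where "i = e div n" and "j = e mod n"
  have n0: "0 < n" using e by (cases n) auto
  have ij: "i < n" "j < n" unfolding i_def j_def using e n0 less_mult_imp_div_less by auto
  have R: "R 0 = n" "R 1 = S" "R (Suc 0) = S" "R 3 = e" and T: "tables 1 1 1 M"
    and O: "\<And>e'. e' < e \<Longrightarrow> M (2 * (n * n) + e') = enc ((A * B) $$ (e' div n, e' mod n))"
    using inv n0 unfolding output_inv_def s by auto
  define u v where "u = rep 1 i" and "v = rep 1 (n + j)"
  have "u < S" "v < S" unfolding u_def v_def using ij by (auto intro: rep_less)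
  moreover have VM: "M (addr S 3 (Suc 0) i 0) = u" "M (addr S 3 (Suc 0) (n + j) 0) = v"
    using T ij unfolding tables_def u_def v_def by auto
  moreover have "M (addr S 2 1 u v) = enc (dot 1 i (n + j))"
    using T ij unfolding tables_def u_def v_def by auto
  then have "M (addr S 2 (Suc 0) u v) = enc ((A * B) $$ (i, j))"
    using dot_root_eq_mult[OF ij] by simp
  moreover have "i < S" "n + j < S" "Suc 0 < S" "0 < S" using ij S_gt S2 by linarith+
  moreover have "n * n < 2 ^ w" "2 * (n * n) < 2 ^ w" "2 * (n * n) + e < 2 ^ w" "n + j < 2 ^ w"
    "e < 2 ^ w" "Suc e < 2 ^ w"
    using e ij square_bounds by linarith+
  moreover have final: "output_inv (Suc e) (R', M(2 * (n * n) + e := enc ((A * B) $$ (i, j))))"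
    if "R' 0 = n" "R' 1 = S" "R' 3 = Suc e" for R'
  proof -
    let ?M = "M(2 * (n * n) + e := enc ((A * B) $$ (i, j)))"
    have "addr S t a b c \<noteq> 2 * (n * n) + e" if "0 < t" for t a b c
      using addr_ge_input[OF that, of "2 * (n * n) + e" a b c] e by simp
    then have "?M (addr S t a b c) = M (addr S t a b c)" if "0 < t" for t a b c
      using that by simp
    then have "tables 1 1 1 ?M" using T unfolding tables_def by simp
    moreover have "?M (2 * (n * n) + e') = enc ((A * B) $$ (e' div n, e' mod n))" if "e' < Suc e" for e'
      using that O by (cases "e' = e") (auto simp: i_def j_def)
    ultimately show ?thesis using that unfolding output_inv_def by simp
  qed
  note [simp] = calculation R w_pos no_overflow mult_2[symmetric] expr_cost_addr_expr
  note [simp del] = binop_val.simps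
  show ?thesis
    unfolding s output_body_def
    apply (rule wp_Seq, rule wp_Assign_val[where v = i])
    subgoal by (simp add: i_def)
    apply (rule wp_Seq, rule wp_Assign_val[where v = j])
    subgoal by (simp add: j_def)
    apply (rule wp_Seq, rule wp_Store_val[where x = "2 * (n * n) + e" and v = "enc ((A * B) $$ (i, j))"])
    subgoal by simp
    subgoal by simp
    apply (rule wp_Assign_val[where v = "Suc e"])
    subgoal by simp
    subgoal by (intro conjI final) simp_all
    done
qed

section \<open>Assembling the loops\<close>

definition class_count :: "nat \<Rightarrow> nat" where
  "class_count p = length (class_reps p (2 * n))"

lemma initialised_regs:
  "initialised m e s \<Longrightarrow> fst s 0 = n \<and> fst s 1 = S \<and> fst s 2 = m \<and> fst s 3 = e"
  unfolding initialised_def by auto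

lemma output_inv_regs: "output_inv e s \<Longrightarrow> fst s 0 = n \<and> fst s 1 = S \<and> fst s 3 = e"
  unfolding output_inv_def by auto

lemma guard_val:
  assumes "fst s 0 = n"
  shows "expr_val w s (Bin Less (Reg r) double_n) = (if fst s r < 2 * n then 1 else 0)"
    and "expr_val w s (Bin Less (Reg r) square_n) = (if fst s r < n * n then 1 else 0)"
  using assms square_bounds
  by (simp_all add: no_overflow mult_2[symmetric] del: binop_val.simps)

lemma init_loop:
  assumes "initialised n 0 s"
  shows "wp w (While (Bin Less (Reg 2) double_n) (Seq (store_table q mult_code) (incr 2))) s
    (\<lambda>t s'. t \<le> n * (15 * (q * q) + 11) + 6 \<and> initialised (2 * n) 0 s')"
proof -
  have "wp w (While (Bin Less (Reg 2) double_n) (Seq (store_table q mult_code) (incr 2))) s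
    (\<lambda>t s'. t \<le> (\<Sum>i<n. 15 * (q * q) + 5 + Suc (expr_cost (Bin Less (Reg 2) double_n)))
      + Suc (expr_cost (Bin Less (Reg 2) double_n)) \<and> initialised (n + n) 0 s')"
  proof (rule wp_While[where I = "\<lambda>i. initialised (n + i) 0"])
    fix i s' assume i: "i < n" and inv: "initialised (n + i) 0 s'"
    have "expr_val w s' (Bin Less (Reg 2) double_n) \<noteq> 0"
      using initialised_regs[OF inv] i by (simp add: guard_val del: expr_val.simps)
    then show "expr_val w s' (Bin Less (Reg 2) double_n) \<noteq> 0 \<and>
        wp w (Seq (store_table q mult_code) (incr 2)) s'
          (\<lambda>t s'. t \<le> 15 * (q * q) + 5 \<and> initialised (n + Suc i) 0 s')"
      using init_body_correct[of "n + i" s'] i inv by simp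
  next
    fix s' assume "initialised (n + n) 0 s'"
    from initialised_regs[OF this] show "expr_val w s' (Bin Less (Reg 2) double_n) = 0"
      by (simp add: guard_val del: expr_val.simps)
  qed (use assms in simp)
  then show ?thesis by (rule wp_mono) (simp add: mult_2[symmetric] algebra_simps)
qed

lemma copy_loop:
  assumes "initialised (2 * n) 0 s"
  shows "wp w (While (Bin Less (Reg 3) square_n) copy_body) s
    (\<lambda>t s'. t \<le> n * n * 86 + 6 \<and> initialised (2 * n) (n * n) s')"
proof -
  have "wp w (While (Bin Less (Reg 3) square_n) copy_body) s
    (\<lambda>t s'. t \<le> (\<Sum>e<n * n. 80 + Suc (expr_cost (Bin Less (Reg 3) square_n)))
      + Suc (expr_cost (Bin Less (Reg 3) square_n)) \<and> initialised (2 * n) (n * n) s')"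
  proof (rule wp_While)
    fix e s' assume e: "e < n * n" and inv: "initialised (2 * n) e s'"
    have "expr_val w s' (Bin Less (Reg 3) square_n) \<noteq> 0"
      using initialised_regs[OF inv] e by (simp add: guard_val del: expr_val.simps)
    then show "expr_val w s' (Bin Less (Reg 3) square_n) \<noteq> 0 \<and>
        wp w copy_body s' (\<lambda>t s'. t \<le> 80 \<and> initialised (2 * n) (Suc e) s')"
      using copy_body_correct[OF e inv] by simp
  next
    fix s' assume "initialised (2 * n) (n * n) s'"
    from initialised_regs[OF this] show "expr_val w s' (Bin Less (Reg 3) square_n) = 0"
      by (simp add: guard_val del: expr_val.simps)
  qed (use assms in simp)
  then show ?thesis by (rule wp_mono) auto
qed

text \<open>Iteration \<open>i\<close> treats node \<open>n - Suc i\<close>, which reindexes the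
  cost as a sum over nodes. The final node \<open>n - (n - 1)\<close> is 1, or 0 for an empty
  matrix.\<close>

lemma node_loop:
  assumes "node_inv n s"
  shows "wp w (While (Bin Less (Const 1) (Reg 2)) node_body) s
    (\<lambda>t s'. t \<le> (\<Sum>p=1..<n. 54 + 312 * n + 256 * (class_count p * class_count p)) + 4 \<and>
      node_inv (n - (n - 1)) s')"
proof -
  let ?g = "\<lambda>p. 50 + 312 * n + 256 * (class_count p * class_count p)"
  have one: "(1::nat) < 2 ^ w" using less_bound by linarith
  have "wp w (While (Bin Less (Const 1) (Reg 2)) node_body) s
    (\<lambda>t s'. t \<le> (\<Sum>i<n - 1. ?g (n - Suc i) + Suc (expr_cost (Bin Less (Const 1) (Reg 2))))
      + Suc (expr_cost (Bin Less (Const 1) (Reg 2))) \<and> node_inv (n - (n - 1)) s')"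
  proof (rule wp_While[where I = "\<lambda>i. node_inv (n - i)"])
    fix i s' assume i: "i < n - 1" and inv: "node_inv (n - i) s'"
    have "expr_val w s' (Bin Less (Const 1) (Reg 2)) \<noteq> 0"
      using inv i one w_pos unfolding node_inv_def
      by (auto simp: no_overflow simp del: binop_val.simps)
    moreover have "n - i = Suc (n - Suc i)" using i by simp
    ultimately show "expr_val w s' (Bin Less (Const 1) (Reg 2)) \<noteq> 0 \<and>
        wp w node_body s' (\<lambda>t s'. t \<le> ?g (n - Suc i) \<and> node_inv (n - Suc i) s')"
      using node_body_correct[of "n - Suc i" s'] i inv unfolding class_count_def by simp
  next
    fix s' assume "node_inv (n - (n - 1)) s'"
    then show "expr_val w s' (Bin Less (Const 1) (Reg 2)) = 0"
      using one w_pos unfolding node_inv_def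
      by (auto simp: no_overflow simp del: binop_val.simps)
  qed (use assms in simp)
  moreover have "(\<Sum>i<n - 1. ?g (n - Suc i) + 4) = (\<Sum>p=1..<n. ?g p + 4)"
    by (rule sum.reindex_bij_witness[where i = "\<lambda>p. n - Suc p" and j = "\<lambda>i. n - Suc i"]) auto
  ultimately show ?thesis by (elim wp_mono) (simp add: eval_nat_numeral)
qed

lemma output_loop:
  assumes "output_inv 0 s"
  shows "wp w (While (Bin Less (Reg 3) square_n) output_body) s
    (\<lambda>t s'. t \<le> n * n * 86 + 6 \<and> output_inv (n * n) s')"
proof -
  have "wp w (While (Bin Less (Reg 3) square_n) output_body) s
    (\<lambda>t s'. t \<le> (\<Sum>e<n * n. 80 + Suc (expr_cost (Bin Less (Reg 3) square_n)))
      + Suc (expr_cost (Bin Less (Reg 3) square_n)) \<and> output_inv (n * n) s')"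
  proof (rule wp_While)
    fix e s' assume e: "e < n * n" and inv: "output_inv e s'"
    have "expr_val w s' (Bin Less (Reg 3) square_n) \<noteq> 0"
      using output_inv_regs[OF inv] e by (simp add: guard_val del: expr_val.simps)
    then show "expr_val w s' (Bin Less (Reg 3) square_n) \<noteq> 0 \<and>
        wp w output_body s' (\<lambda>t s'. t \<le> 80 \<and> output_inv (Suc e) s')"
      using output_body_correct[OF e inv] by simp
  next
    fix s' assume "output_inv (n * n) s'"
    from output_inv_regs[OF this] show "expr_val w s' (Bin Less (Reg 3) square_n) = 0"
      by (simp add: guard_val del: expr_val.simps)
  qed (use assms in simp)
  then show ?thesis by (rule wp_mono) auto
qed

lemma output_inv_imp_output_is:
  assumes "output_inv (n * n) s"
  shows "output_is enc n (A * B) s"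
  unfolding output_is_def
proof (intro allI impI)
  fix i j assume ij: "i < n" "j < n"
  have "i * n + j < n * n" using ij mult_right_mono[of "Suc i" n n] by simp
  moreover have "(i * n + j) div n = i" "(i * n + j) mod n = j" using ij(2) by auto
  moreover have "snd s (2 * (n * n) + e) = enc ((A * B) $$ (e div n, e mod n))" if "e < n * n" for e
    using assms that unfolding output_inv_def by auto
  ultimately have "snd s (2 * (n * n) + (i * n + j)) = enc ((A * B) $$ (i, j))"
    by metis
  then show "snd s (2 * (n * n) + i * n + j) = enc ((A * B) $$ (i, j))"
    by (simp add: add.assoc)
qed

lemma mult_prog_correct:
  "wp w (mult_prog q add_code mult_code) (input_state enc n A B)
    (\<lambda>t s. t \<le> 60 + 15 * (q * q) * (n + 1) + 11 * n + 172 * (n * n)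
        + (\<Sum>p=1..<n. 54 + 312 * n + 256 * (class_count p * class_count p)) \<and>
      output_is enc n (A * B) s)"
proof -
  obtain R M where s: "input_state enc n A B = (R, M)" by (cases "input_state enc n A B")
  have R: "R = (\<lambda>_. 0)(0 := n)" and M: "M = snd (input_state enc n A B)"
    using s unfolding input_state_def by auto
  have zero: "M (addr S t a b c) = 0" if "0 < t" for t a b c
  proof -
    have "\<not> addr S t a b c < 2 * (n * n)"
      using addr_ge_input[OF that, of "addr S t a b c" a b c] by linarith
    then show ?thesis unfolding M input_state_def by (auto simp: not_less)
  qed
  have lt: "n < 2 ^ w" "q < 2 ^ w" "S < 2 ^ w" "2 * n + q < 2 ^ w" using S_eq S_gt S_le by linarith+
  \<comment> \<open>Registers 2 and 3 are 0 in the input state: the addition table thus lands at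
    node 0, and the copy loop later starts at 0 without a reset.\<close>
  have init: "initialised n 0 (R(1 := S, 2 := n), M')"
    if tab: "\<forall>a<q. \<forall>b<q. M' (addr S 2 0 a b) = add_code a b"
      and frame: "\<forall>x. (\<forall>a<S. \<forall>b<S. x \<noteq> addr S 2 0 a b) \<longrightarrow> M' x = M x" for M'
  proof -
    have "M' x = M x" if "x < 2 * (n * n)" for x
    proof -
      have "x < 3 * (n * n)" using that by simp
      then have "x \<noteq> addr S 2 0 a b" for a b
        using addr_ge_input[of 2 x 0 a b] by auto
      then show ?thesis using frame by blast
    qed
    moreover have "M' (addr S 5 p x y) = M (addr S 5 p x y)" if "p < S" "x < S" "y < S" for p x y
      using frame that S_gt by (auto simp: addr_eq_iff)
    ultimately show ?thesis using tab M zero unfolding initialised_def R by simp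
  qed
  show ?thesis
    unfolding s mult_prog_def
    apply (rule wp_Seq, rule wp_Assign_val[where v = S])
    subgoal using lt R S_eq
      by (simp add: no_overflow mult_2[symmetric] del: binop_val.simps)
    apply (rule wp_Seq, rule wp_mono[OF wp_store_table])
    subgoal by simp
    subgoal using S_gt by (simp add: R)
    subgoal by (rule S_gt)
    subgoal by (rule code_less)
    subgoal premises p1 for t1 s1
      apply (subst prod.collapse[symmetric, of s1])
      apply (rule wp_Seq, rule wp_Assign_val[where v = n])
      subgoal using p1 R by simp
      apply (rule wp_Seq, rule wp_mono[OF init_loop])
      subgoal using init[of "snd s1"] p1 by (simp add: R)
      subgoal premises p2 for t2 s2
        apply (rule wp_Seq, rule wp_mono[OF copy_loop])
        subgoal using p2 by simp
        subgoal premises p3 for t3 s3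
          apply (subst prod.collapse[symmetric, of s3])
          apply (rule wp_Seq, rule wp_Assign_val[where v = n])
          subgoal using p3 unfolding initialised_def by auto
          apply (rule wp_Seq, rule wp_mono[OF node_loop])
          subgoal using p3 by (intro initialised_imp_node_inv) (auto simp: initialised_def)
          subgoal premises p4 for t4 s4
            apply (subst prod.collapse[symmetric, of s4])
            apply (rule wp_Seq, rule wp_Assign_val[where v = 0])
            subgoal by simp
            apply (rule wp_mono[OF output_loop])
            subgoal using p4 unfolding output_inv_def node_inv_def by auto
            subgoal for t5 s5
              using p1 p2 p3 p4 output_inv_imp_output_is[of s5] by (simp add: algebra_simps)
            done
          done
        done
      done
    done
qed

section \<open>Running time\<close>

lemma card_entries: "CARD('a) = q"
  using bij_betw_same_card[OF enc] by simp

text \<open>Representatives among the rows differ pairwise on the leaves of \<open>p\<close>, and so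
  do those among the columns. The 4 is one factor 2 for these two kinds and one from
  \<open>card_leaves_le\<close>.\<close>

lemma class_count_le:
  assumes tw: "twin_width (matrix_structure A) \<le> d" "twin_width (matrix_structure B) \<le> d"
    and p: "0 < p" "p < n"
  shows "p * class_count p \<le> 4 * ((d + 2) * q ^ (d + 1)) * n"
proof -
  define c where "c = (d + 2) * q ^ (d + 1)"
  define I where "I = {i. i < n \<and> rep p i = i}"
  define J where "J = {j. j < n \<and> rep p (n + j) = n + j}"
  have K: "leaves p \<subseteq> {..<n}" "leaves p \<noteq> {}"
    using leaves_subset[of p] leaves_nonempty p by auto
  have sub: "I \<subseteq> {..<n}" "J \<subseteq> {..<n}" unfolding I_def J_def by auto
  have "card I \<le> c * card (leaves p)"
    unfolding c_def card_entries[symmetric]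
  proof (rule card_distinct_rows_cols_le(1)[OF A tw(1) K sub(1)])
    fix i i' assume i: "i \<in> I" "i' \<in> I" and eq: "\<forall>k\<in>leaves p. A $$ (i, k) = A $$ (i', k)"
    then have "rep p i = rep p i'"
      using p unfolding I_def by (subst rep_eq_iff) (auto simp: vec_entry_def)
    then show "i = i'" using i unfolding I_def by simp
  qed
  moreover have "card J \<le> c * card (leaves p)"
    unfolding c_def card_entries[symmetric]
  proof (rule card_distinct_rows_cols_le(2)[OF B tw(2) K sub(2)])
    fix j j' assume j: "j \<in> J" "j' \<in> J" and eq: "\<forall>k\<in>leaves p. B $$ (k, j) = B $$ (k, j')"
    then have "rep p (n + j) = rep p (n + j')"
      using p unfolding J_def by (subst rep_eq_iff) (auto simp: vec_entry_def)
    then show "j = j'" using j unfolding J_def by simp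
  qed
  moreover have "class_count p \<le> card I + card J"
  proof -
    have "class_count p = card (set (class_reps p (2 * n)))"
      unfolding class_count_def
      by (rule distinct_card[symmetric]) (simp add: class_reps_def)
    also have "set (class_reps p (2 * n)) = {i. i < 2 * n \<and> rep p i = i}"
      unfolding class_reps_def by auto
    also have "\<dots> \<subseteq> I \<union> (\<lambda>j. n + j) ` J"
    proof
      fix i assume "i \<in> {i. i < 2 * n \<and> rep p i = i}"
      then show "i \<in> I \<union> (\<lambda>j. n + j) ` J"
        unfolding I_def J_def by (cases "i < n") (auto intro!: image_eqI[of _ _ "i - n"])
    qed
    then have "card {i. i < 2 * n \<and> rep p i = i} \<le> card (I \<union> (\<lambda>j. n + j) ` J)"
      by (rule card_mono[rotated]) (auto simp: I_def J_def)
    also have "\<dots> \<le> card I + card ((\<lambda>j. n + j) ` J)" by (rule card_Un_le)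
    also have "card ((\<lambda>j. n + j) ` J) = card J" by (rule card_image) simp
    finally show ?thesis by simp
  qed
  ultimately have "class_count p \<le> 2 * c * card (leaves p)" by simp
  then have "p * class_count p \<le> p * (2 * c * card (leaves p))" by simp
  also have "\<dots> = 2 * c * (p * card (leaves p))" by simp
  also have "\<dots> \<le> 2 * c * (2 * n)" using card_leaves_le[of p] p by (intro mult_left_mono) auto
  finally have "p * class_count p \<le> 4 * c * n" by simp
  then show ?thesis unfolding c_def .
qed

end

lemma sum_inverse_squares_le: "(\<Sum>p=1..<n. 1 / (real p)\<^sup>2) \<le> 2"
proof -
  \<comment> \<open>Strengthened to \<open>2 - 1 / real n\<close> so that the induction telescopes
    by \<open>1 / (n + 1)^2 \<le> 1 / n - 1 / (n + 1)\<close>.\<close>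
  have "(\<Sum>p=1..<Suc n. 1 / (real p)\<^sup>2) \<le> 2 - 1 / real n" if "0 < n" for n
    using that
  proof (induction n rule: nat_induct_non_zero)
    case (Suc n)
    have "1 / (real (Suc n))\<^sup>2 \<le> 1 / (real n * real (Suc n))"
      using Suc by (intro divide_left_mono) (auto simp: power2_eq_square intro: mult_right_mono)
    also have "\<dots> = 1 / real n - 1 / real (Suc n)" using Suc by (simp add: field_simps)
    finally show ?case using Suc by simp
  qed simp
  note le = this
  show ?thesis
  proof (cases "1 < n")
    case True
    then have "(\<Sum>p=1..<n. 1 / (real p)\<^sup>2) \<le> 2 - 1 / real (n - 1)" using le[of "n - 1"] by simp
    also have "\<dots> \<le> 2" by (simp del: of_nat_diff)
    finally show ?thesis .
  qed simp
qed

lemma sum_squares_le: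
  fixes f :: "nat \<Rightarrow> nat"
  assumes "\<And>p. 0 < p \<Longrightarrow> p < n \<Longrightarrow> p * f p \<le> K"
  shows "(\<Sum>p=1..<n. f p * f p) \<le> 2 * (K * K)"
proof -
  have "real (\<Sum>p=1..<n. f p * f p) = (\<Sum>p=1..<n. (real (f p))\<^sup>2)"
    by (simp add: power2_eq_square)
  also have "\<dots> \<le> (\<Sum>p=1..<n. (real K)\<^sup>2 * (1 / (real p)\<^sup>2))"
  proof (rule sum_mono)
    fix p assume "p \<in> {1..<n}"
    then have p: "0 < p" "p * f p \<le> K" using assms by auto
    then have "real p * real (f p) \<le> real K" by (metis of_nat_le_iff of_nat_mult)
    then have "real (f p) \<le> real K / real p" using p by (simp add: field_simps)
    then have "(real (f p))\<^sup>2 \<le> (real K / real p)\<^sup>2" by (rule power_mono) simp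
    then show "(real (f p))\<^sup>2 \<le> (real K)\<^sup>2 * (1 / (real p)\<^sup>2)" by (simp add: power_divide)
  qed
  also have "\<dots> = (real K)\<^sup>2 * (\<Sum>p=1..<n. 1 / (real p)\<^sup>2)" by (rule sum_distrib_left[symmetric])
  also have "\<dots> \<le> (real K)\<^sup>2 * 2" by (intro mult_left_mono sum_inverse_squares_le) simp
  also have "\<dots> = real (2 * (K * K))" by (simp add: power2_eq_square)
  finally show ?thesis by (simp only: of_nat_le_iff)
qed

text \<open>Origin of \<open>k\<close>: \<open>2 * n + q \<le> (q + 2) * (n + 2)\<close> gives
  exponent 3, and the remaining factor \<open>x = 6 * (q + 2) ^ 3\<close> is absorbed by
  \<open>x < 2 ^ x \<le> (n + 2) ^ x\<close>.\<close>

lemma word_bound_from_log: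
  fixes n q w :: nat
  assumes "real (3 + 6 * (q + 2) ^ 3) * log 2 (real n + 2) \<le> real w"
  shows "6 * (2 * n + q) ^ 3 \<le> 2 ^ w"
proof -
  let ?k = "3 + 6 * (q + 2) ^ 3"
  have "2 * n + q \<le> (q + 2) * (n + 2)" by (simp add: algebra_simps)
  then have "(2 * n + q) ^ 3 \<le> (q + 2) ^ 3 * (n + 2) ^ 3"
    by (metis power_mono power_mult_distrib zero_le)
  then have "6 * (2 * n + q) ^ 3 \<le> 6 * (q + 2) ^ 3 * (n + 2) ^ 3" by simp
  also have "\<dots> \<le> 2 ^ (6 * (q + 2) ^ 3) * (n + 2) ^ 3"
    by (intro mult_right_mono less_imp_le less_exp) simp
  also have "\<dots> \<le> (n + 2) ^ (6 * (q + 2) ^ 3) * (n + 2) ^ 3"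
    by (intro mult_right_mono power_mono) auto
  also have "\<dots> = (n + 2) ^ ?k" by (simp only: power_add mult.commute)
  finally have le: "6 * (2 * n + q) ^ 3 \<le> (n + 2) ^ ?k" .
  have "real ((n + 2) ^ ?k) = (real n + 2) ^ ?k"
    by (simp only: of_nat_power of_nat_add of_nat_numeral)
  also have "\<dots> = (real n + 2) powr real ?k"
    by (rule powr_realpow[symmetric]) simp
  also have "\<dots> = 2 powr (real ?k * log 2 (real n + 2))"
    by (simp add: powr_def log_def)
  also have "\<dots> \<le> 2 powr real w" using assms by (intro powr_mono) auto
  also have "\<dots> = real (2 ^ w)" by (simp add: powr_realpow)
  finally have "(n + 2) ^ ?k \<le> 2 ^ w" by (simp only: of_nat_le_iff)
  with le show ?thesis by (rule le_trans)
qed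

text \<open>Here \<open>65 = 11 + 54\<close> and \<open>484 = 172 + 312\<close> collect the loops,
  and \<open>8192 = 256 * 2 * 4 * 4\<close> comes from \<open>sum_squares_le\<close> with
  \<open>K = 4 * c * n\<close>.\<close>

definition mult_time :: "nat \<Rightarrow> nat \<Rightarrow> nat \<Rightarrow> nat" where
  "mult_time q c n = 60 + 15 * (q * q) * (n + 1) + 65 * n + (484 + 8192 * (c * c)) * (n * n)"

lemma mult_time_bigo: "(\<lambda>n. real (mult_time q c n)) \<in> O(\<lambda>n. real n ^ 2 * ln (real n))"
proof (rule bigoI)
  let ?C = "real (609 + 30 * (q * q) + 8192 * (c * c))"
  show "\<forall>\<^sub>F n in sequentially. norm (real (mult_time q c n)) \<le> ?C * norm (real n ^ 2 * ln (real n))"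
    \<comment> \<open>The time is quadratic; from 3 on \<open>1 \<le> ln (real n)\<close>, so the
      logarithm can be multiplied in.\<close>
    using eventually_ge_at_top[of 3]
  proof eventually_elim
    case (elim n)
    have le: "1 \<le> n * n" "n \<le> n * n" using elim by auto
    then have le': "n + 1 \<le> 2 * (n * n)" by linarith
    have "mult_time q c n \<le> 60 * (n * n) + 15 * (q * q) * (2 * (n * n)) + 65 * (n * n)
        + (484 + 8192 * (c * c)) * (n * n)"
      unfolding mult_time_def using le le' by (intro add_mono mult_left_mono) auto
    also have "\<dots> = (609 + 30 * (q * q) + 8192 * (c * c)) * (n * n)" by (simp add: algebra_simps)
    finally have "real (mult_time q c n) \<le> real ((609 + 30 * (q * q) + 8192 * (c * c)) * (n * n))"
      by (simp only: of_nat_le_iff)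
    also have "\<dots> = ?C * (real n)\<^sup>2" by (simp only: of_nat_mult power2_eq_square)
    also have "1 \<le> ln (real n)"
      using elim exp_le by (subst ln_ge_iff) (auto intro: order_trans)
    then have "?C * (real n)\<^sup>2 * 1 \<le> ?C * (real n)\<^sup>2 * ln (real n)" by (intro mult_left_mono) auto
    also have "\<dots> = ?C * norm (real n ^ 2 * ln (real n))"
      using \<open>1 \<le> ln (real n)\<close> by (simp add: abs_mult)
    finally show ?case by simp
  qed
qed

theorem theorem46:
  fixes q d :: nat
  assumes "primepow q"
    and "card (UNIV :: 'a::{field, finite} set) = q"
  shows "\<exists>T k. (\<lambda>n. real (T n)) \<in> O(\<lambda>n. real n ^ 2 * ln (real n)) \<and>
    (\<forall>enc :: 'a \<Rightarrow> nat. bij_betw enc UNIV {..<q} \<longrightarrow>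
      (\<exists>prog. multiplies_within (\<lambda>A. twin_width (matrix_structure A) \<le> d) enc k T prog))"
proof (intro exI conjI allI impI)
  define c where "c = (d + 2) * q ^ (d + 1)"
  show "(\<lambda>n. real (mult_time q c n)) \<in> O(\<lambda>n. real n ^ 2 * ln (real n))"
    by (rule mult_time_bigo)
  fix enc :: "'a \<Rightarrow> nat" assume enc: "bij_betw enc UNIV {..<q}"
  \<comment> \<open>Time bound and word constant depend only on \<open>q\<close> and
    \<open>d\<close>; the encoding enters only the constants of the two operation tables in the
    program.\<close>
  show "multiplies_within (\<lambda>A. twin_width (matrix_structure A) \<le> d) enc (3 + 6 * (q + 2) ^ 3)
    (mult_time q c) (mult_prog q (mult_instance.add_code enc) (mult_instance.mult_code enc))"
    unfolding multiplies_within_def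
  proof (intro allI impI ballI)
    fix n w and A B :: "'a mat"
    assume A: "A \<in> carrier_mat n n" and B: "B \<in> carrier_mat n n"
      and tw: "twin_width (matrix_structure A) \<le> d" "twin_width (matrix_structure B) \<le> d"
      and w: "real (3 + 6 * (q + 2) ^ 3) * log 2 (real n + 2) \<le> real w"
    interpret mult_instance A B n q w enc "2 * n + q"
      using A B enc word_bound_from_log[OF w] by unfold_locales auto
    obtain t s where run: "exec w (mult_prog q add_code mult_code) (input_state enc n A B) t s"
      and t: "t \<le> 60 + 15 * (q * q) * (n + 1) + 11 * n + 172 * (n * n)
        + (\<Sum>p=1..<n. 54 + 312 * n + 256 * (class_count p * class_count p))"
      and out: "output_is enc n (A * B) s"
      using mult_prog_correct unfolding wp_def by blast
    have "(\<Sum>p=1..<n. class_count p * class_count p) \<le> 2 * ((4 * c * n) * (4 * c * n))"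
      using class_count_le[OF tw] unfolding c_def by (intro sum_squares_le) simp
    moreover have "(\<Sum>p=1..<n. 54 + 312 * n + 256 * (class_count p * class_count p))
        = (n - 1) * (54 + 312 * n) + 256 * (\<Sum>p=1..<n. class_count p * class_count p)"
      by (simp add: sum.distrib sum_distrib_left)
    moreover have "(n - 1) * (54 + 312 * n) \<le> n * (54 + 312 * n)" by (rule mult_right_mono) auto
    ultimately have "t \<le> mult_time q c n"
      using t unfolding mult_time_def by (simp add: algebra_simps)
    then show "\<exists>t s. exec w (mult_prog q add_code mult_code) (input_state enc n A B) t s \<and>
        t \<le> mult_time q c n \<and> output_is enc n (A * B) s"
      using run out by blast
  qed
qed

end
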